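(* Let $G=G_p$ be the group of parabolic rotations acting diagonally on $\mathbb R^6$, and put $\zeta_1=x_2-x_3$, $\zeta_2=y_2-y_3$, $\zeta_3=y_1^2+y_2^2-y_3^2$, $\zeta_6=x_1(y_2-y_3)+y_1(x_3-x_2)$. (a) The $G$-orbit of every point of $T\mathbb H^2$ is a parabola which lies in a two-dimensional affine subspace of $\mathbb R^6$. (b) The map $\Gamma:V\to\mathbb R^4$, $z\mapsto w=(w_1,w_2,w_3,w_4)^{\rm tr}=(\zeta_1(z),\zeta_2(z),\zeta_3(z),\zeta_6(z))^{\rm tr}$, sends $V$ to the variety $Y\subseteq\mathbb R^4$ defined by $$w_4^2=w_1^2w_3-w_2^2 .$$ (c) The image of $T\mathbb H^2$ under $\Gamma$ is equal to $\{w\in Y:\ w_1<0\}$. In particular the Zariski closure of $\Gamma(V)$ equals $Y$. (d) The Dirac-Poisson bracket $\{\cdot,\cdot\}^*$ on $V$ induces a Poisson bracket $\{\cdot,\cdot\}'$ on $Y$, which is determined by $$\{w_1,w_2\}'=w_1^2,\quad \{w_2,w_3\}'=2w_1w_3,\quad \{w_3,w_1\}'=-2w_2,$$ and $\{w_i,w_4\}'=0$ for $1\le i\le 3$. (e) For the Hamiltonian $H=\frac12\zeta_3+U(\zeta_1)$ with axisymmetric potential $U=U(x_2-x_3)$, $U$ a polynomial or rational function, the equations of motion on $T\mathbb H^2$, $$\dot x=y,\qquad \dot y=-\nabla_L^xU+x\left(\langle y,y\rangle_L-\langle x,\nabla_L^xU\rangle_L\right),$$ are mapped by $\Gamma$ to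 the reduced Hamiltonian system $$\dot w_1=\{w_1,h\}'=w_2,\quad \dot w_2=\{w_2,h\}'=w_1w_3-w_1^2U'(w_1),$$ $$\dot w_3=\{w_3,h\}'=-2w_2U'(w_1),\quad \dot w_4=\{w_4,h\}'=0$$ on $Y$, with $h(w):=\frac12w_3+U(w_1)$. This system admits the first integrals $h$ and $w_4$.
   Context: Coordinates on $\mathbb R^6$ (identified with the tangent bundle $T\mathbb R^{2,1}$ of Minkowski space) are $(x,y)=(x_1,x_2,x_3,y_1,y_2,y_3)$. The Lorentz pseudo inner product is $\langle u,v\rangle_L=u_1v_1+u_2v_2-u_3v_3$, and $\nabla_L^xf=(\partial f/\partial x_1,\partial f/\partial x_2,-\partial f/\partial x_3)^{\rm tr}$. In (e), $\nabla_L^xU$ is the Lorentz gradient of the function $x\mapsto U(x_2-x_3)$, and $U'$ is the derivative of the one-variable function $U$. Put $$V=\{(x,y)\in\mathbb R^6:\langle x,x\rangle_L+1=0,\ \langle x,y\rangle_L=0\},\qquad T\mathbb H^2=\{(x,y)\in V: x_3>0\}.$$ For $A\in GL(3,\mathbb R)$ the diagonal action on $\mathbb R^6$ is $(x,y)\mapsto(Ax,Ay)$. The group $G_p$ of parabolic rotations consists of the matrices $\begin{pmatrix} 1 & -s & s \\ s & 1-s^2/2 & s^2/2 \\ s & -s^2/2 & 1+s^2/2 \end{pmatrix}$, $s\in\mathbb R$. For a real variety $Z$, $\mathbb R[Z]$ is the algebra of restrictions of polynomials to $Z$; a Poisson bracket on $Z$ is a skew-symmetric bilinear map $\mathbb R[Z]\times\mathbb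 R[Z]\to\mathbb R[Z]$ satisfying the Leibniz rule and the Jacobi identity. The Dirac-Poisson bracket $\{\cdot,\cdot\}^*$ on $V$ is the Poisson bracket determined by $\{x_i,x_j\}^*=0$, $\{x_i,y_j\}^*=g_{ij}+x_ix_j$, $\{y_i,y_j\}^*=x_iy_j-x_jy_i$, where $(g_{ij})={\rm diag}(1,1,-1)$. That it "induces" a bracket $\{\cdot,\cdot\}'$ on $Y$ means that $\{\cdot,\cdot\}'$ is a Poisson bracket on $Y$ with $\{\phi\circ\Gamma,\psi\circ\Gamma\}^*=\{\phi,\psi\}'\circ\Gamma$ for all $\phi,\psi\in\mathbb R[Y]$. For rational (or smooth) $h$ the bracket $\{w_i,h\}'=\sum_j\{w_i,w_j\}'\,\partial h/\partial w_j$ is used where $h$ is defined. "Mapped by $\Gamma$" means that $\Gamma$ maps parameterized solutions to parameterized solutions. *)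

theory Defs
  imports "HOL-Analysis.Analysis" "HOL-Computational_Algebra.Polynomial"
begin

text \<open>Points \<open>(x, y)\<close> of \<open>\<real>\<^sup>6\<close> are elements of \<open>(real^3) \<times> (real^3)\<close>, which carries the
  Euclidean norm of \<open>\<real>\<^sup>6\<close>.\<close>

type_synonym phase = "(real^3) \<times> (real^3)"

definition lorentz :: "real^3 \<Rightarrow> real^3 \<Rightarrow> real" where
  "lorentz u v = u$1 * v$1 + u$2 * v$2 - u$3 * v$3"

definition lorentz_metric :: "3 \<Rightarrow> 3 \<Rightarrow> real" where
  "lorentz_metric i j = (if i = j then (if i = 3 then -1 else 1) else 0)"

definition V :: "phase set" where
  "V = {(x, y). lorentz x x + 1 = 0 \<and> lorentz x y = 0}"

definition TH2 :: "phase set" where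
  "TH2 = {(x, y) \<in> V. x$3 > 0}"

definition parabolic_rotation :: "real \<Rightarrow> real^3^3" where
  "parabolic_rotation s = vector
     [vector [1, -s, s],
      vector [s, 1 - s^2/2, s^2/2],
      vector [s, - (s^2/2), 1 + s^2/2]]"

definition parabolic_rotations :: "(real^3^3) set" where
  "parabolic_rotations = range parabolic_rotation"

definition orbit :: "(real^3^3) set \<Rightarrow> phase \<Rightarrow> phase set" where
  "orbit G z = {(A *v fst z, A *v snd z) | A. A \<in> G}"

text \<open>Focus-directrix definition; it is meant for an affine plane \<open>P\<close>.\<close>

definition parabola_in_plane :: "'a::euclidean_space set \<Rightarrow> 'a set \<Rightarrow> bool" where
  "parabola_in_plane P S \<longleftrightarrow>
     (\<exists>F L. F \<in> P \<and> L \<subseteq> P \<and> affine L \<and> aff_dim L = 1 \<and> F \<notin> L \<and>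
            S = {p \<in> P. dist p F = infdist p L})"

definition zeta1 :: "phase \<Rightarrow> real" where
  "zeta1 = (\<lambda>(x, y). x$2 - x$3)"
definition zeta2 :: "phase \<Rightarrow> real" where
  "zeta2 = (\<lambda>(x, y). y$2 - y$3)"
definition zeta3 :: "phase \<Rightarrow> real" where
  "zeta3 = (\<lambda>(x, y). (y$1)^2 + (y$2)^2 - (y$3)^2)"
definition zeta6 :: "phase \<Rightarrow> real" where
  "zeta6 = (\<lambda>(x, y). x$1 * (y$2 - y$3) + y$1 * (x$3 - x$2))"

definition Gam :: "phase \<Rightarrow> real^4" where
  "Gam z = vector [zeta1 z, zeta2 z, zeta3 z, zeta6 z]"

definition Y :: "(real^4) set" where
  "Y = {w. (w$4)^2 = (w$1)^2 * w$3 - (w$2)^2}"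

definition zariski_closure :: "'a::real_normed_vector set \<Rightarrow> 'a set" where
  "zariski_closure S =
     {w. \<forall>p. real_polynomial_function p \<and> (\<forall>v\<in>S. p v = 0) \<longrightarrow> p w = 0}"

text \<open>The elements of \<open>\<real>[Z]\<close> are restrictions of polynomials, represented as extensional
  functions (with the value \<open>undefined\<close> outside \<open>Z\<close>).\<close>

definition coord_ring :: "'a::real_normed_vector set \<Rightarrow> ('a \<Rightarrow> real) set" where
  "coord_ring Z = {restrict p Z | p. real_polynomial_function p}"

type_synonym 'a bracket = "('a \<Rightarrow> real) \<Rightarrow> ('a \<Rightarrow> real) \<Rightarrow> ('a \<Rightarrow> real)"

text \<open>Only the values on arguments from \<open>\<real>[Z]\<close> matter.  Linearity and the Leibniz rule in the
  second argument follow by skew-symmetry.\<close>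

definition poisson_bracket :: "'a::real_normed_vector set \<Rightarrow> 'a bracket \<Rightarrow> bool" where
  "poisson_bracket Z B \<longleftrightarrow>
     (\<forall>f\<in>coord_ring Z. \<forall>g\<in>coord_ring Z. B f g \<in> coord_ring Z) \<and>
     (\<forall>f\<in>coord_ring Z. \<forall>g\<in>coord_ring Z. \<forall>z\<in>Z. B f g z = - B g f z) \<and>
     (\<forall>f\<in>coord_ring Z. \<forall>g\<in>coord_ring Z. \<forall>k\<in>coord_ring Z. \<forall>a b. \<forall>z\<in>Z.
        B (\<lambda>u\<in>Z. a * f u + b * g u) k z = a * B f k z + b * B g k z) \<and>
     (\<forall>f\<in>coord_ring Z. \<forall>g\<in>coord_ring Z. \<forall>k\<in>coord_ring Z. \<forall>z\<in>Z.
        B (\<lambda>u\<in>Z. f u * g u) k z = f z * B g k z + B f k z * g z) \<and>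
     (\<forall>f\<in>coord_ring Z. \<forall>g\<in>coord_ring Z. \<forall>k\<in>coord_ring Z. \<forall>z\<in>Z.
        B f (B g k) z + B g (B k f) z + B k (B f g) z = 0)"

definition xcoord :: "3 \<Rightarrow> phase \<Rightarrow> real" where
  "xcoord i = (\<lambda>(x, y)\<in>V. x$i)"
definition ycoord :: "3 \<Rightarrow> phase \<Rightarrow> real" where
  "ycoord i = (\<lambda>(x, y)\<in>V. y$i)"
definition wcoord :: "4 \<Rightarrow> real^4 \<Rightarrow> real" where
  "wcoord i = (\<lambda>w\<in>Y. w$i)"

definition dirac_poisson_bracket :: "phase bracket \<Rightarrow> bool" where
  "dirac_poisson_bracket B \<longleftrightarrow>
     poisson_bracket V B \<and>
     (\<forall>i j. \<forall>(x, y)\<in>V.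
        B (xcoord i) (xcoord j) (x, y) = 0 \<and>
        B (xcoord i) (ycoord j) (x, y) = lorentz_metric i j + x$i * x$j \<and>
        B (ycoord i) (ycoord j) (x, y) = x$i * y$j - x$j * y$i)"

definition induces_bracket ::
  "('a::real_normed_vector \<Rightarrow> 'b::real_normed_vector) \<Rightarrow>
     'a set \<Rightarrow> 'a bracket \<Rightarrow> 'b set \<Rightarrow> 'b bracket \<Rightarrow> bool" where
  "induces_bracket \<Gamma> X B Z B' \<longleftrightarrow>
     poisson_bracket Z B' \<and>
     (\<forall>\<phi>\<in>coord_ring Z. \<forall>\<psi>\<in>coord_ring Z. \<forall>z\<in>X.
        B (\<lambda>u\<in>X. \<phi> (\<Gamma> u)) (\<lambda>u\<in>X. \<psi> (\<Gamma> u)) z = B' \<phi> \<psi> (\<Gamma> z))"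

definition reduced_relations :: "(real^4) bracket \<Rightarrow> bool" where
  "reduced_relations B \<longleftrightarrow>
     (\<forall>w\<in>Y. B (wcoord 1) (wcoord 2) w = (w$1)^2 \<and>
            B (wcoord 2) (wcoord 3) w = 2 * w$1 * w$3 \<and>
            B (wcoord 3) (wcoord 1) w = - 2 * w$2 \<and>
            (\<forall>i\<in>{1, 2, 3}. B (wcoord i) (wcoord 4) w = 0))"

definition partial_deriv :: "('a::real_normed_vector \<Rightarrow> real) \<Rightarrow> 'a \<Rightarrow> 'a \<Rightarrow> real" where
  "partial_deriv f b z = deriv (\<lambda>t. f (z + t *\<^sub>R b)) 0"

definition lorentz_grad :: "(real^3 \<Rightarrow> real) \<Rightarrow> real^3 \<Rightarrow> real^3" where
  "lorentz_grad f x = vector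
     [partial_deriv f (axis 1 1) x, partial_deriv f (axis 2 1) x, - partial_deriv f (axis 3 1) x]"

text \<open>Extension of \<open>B f\<close> to functions \<open>h\<close> on the ambient space that need not be polynomial, by
  \<open>{f, h} = \<Sum>\<^sub>j {f, z\<^sub>j} \<partial>h/\<partial>z\<^sub>j\<close> with \<open>z\<^sub>j\<close> the standard coordinates.\<close>

definition bracket_ext ::
  "'a::euclidean_space set \<Rightarrow> 'a bracket \<Rightarrow> ('a \<Rightarrow> real) \<Rightarrow> ('a \<Rightarrow> real) \<Rightarrow> 'a \<Rightarrow> real" where
  "bracket_ext Z B f h z = (\<Sum>b\<in>Basis. B f (\<lambda>u\<in>Z. u \<bullet> b) z * partial_deriv h b z)"

definition hamiltonian :: "(real \<Rightarrow> real) \<Rightarrow> phase \<Rightarrow> real" where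
  "hamiltonian U z = zeta3 z / 2 + U (zeta1 z)"

definition reduced_hamiltonian :: "(real \<Rightarrow> real) \<Rightarrow> real^4 \<Rightarrow> real" where
  "reduced_hamiltonian U w = w$3 / 2 + U (w$1)"

definition motion_field :: "(real \<Rightarrow> real) \<Rightarrow> phase \<Rightarrow> phase" where
  "motion_field U = (\<lambda>(x, y).
     let grad = lorentz_grad (\<lambda>x. U (x$2 - x$3)) x
     in (y, - grad + (lorentz y y - lorentz x grad) *\<^sub>R x))"

definition reduced_field :: "(real \<Rightarrow> real) \<Rightarrow> real^4 \<Rightarrow> real^4" where
  "reduced_field U w = vector
     [w$2, w$1 * w$3 - (w$1)^2 * deriv U (w$1), - 2 * w$2 * deriv U (w$1), 0]"

definition solution_on ::
  "('a::real_normed_vector \<Rightarrow> 'a) \<Rightarrow> 'a set \<Rightarrow> real set \<Rightarrow> (real \<Rightarrow> 'a) \<Rightarrow> bool" where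
  "solution_on F D I c \<longleftrightarrow>
     is_interval I \<and>
     (\<forall>t\<in>I. c t \<in> D \<and> (c has_vector_derivative F (c t)) (at t within I))"

definition first_integral ::
  "('a::real_normed_vector \<Rightarrow> 'a) \<Rightarrow> 'a set \<Rightarrow> ('a \<Rightarrow> real) \<Rightarrow> bool" where
  "first_integral F D f \<longleftrightarrow>
     (\<forall>I c. solution_on F D I c \<longrightarrow> (\<exists>k. \<forall>t\<in>I. f (c t) = k))"

end

theory Submission
  imports Defs
begin

text \<open>
  The proof rests on the description of a Poisson bracket on a variety \<open>Z\<close> by the vector fields of
  the coordinates.  A bracket that satisfies the Leibniz rule is determined by its values on
  coordinates, through the chain rule (\<open>biderivation_eq_bracket_ext\<close>), and it satisfies the Jacobi
  identity if coordinates do (\<open>poisson_bracket_if_jacobi_on_coords\<close>).  Conversely, given polynomial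
  vector fields that are skew and satisfy the Jacobi identity for coordinates, the bracket of
  polynomials on the ambient space restricts to \<open>Z\<close> precisely because the fields are tangent to
  \<open>Z\<close> (\<open>poisson_bracket_from_hamiltonian_fields\<close>).  For the Dirac-Poisson bracket the fields are
  \<open>dirac_field\<close>, and tangency at a point of \<open>V\<close> is seen from a curve in \<open>V\<close>
  (\<open>partial_deriv_tangent_V\<close>).

  The reduced bracket is obtained by pulling back.  The brackets of the components of \<open>\<Gamma>\<close> are
  polynomials in these components (\<open>dirac_field_Gam_grad\<close>), so the functions pulled back from \<open>Y\<close>
  are closed under the bracket of \<open>V\<close>; since \<open>\<Gamma>(V)\<close> is Zariski dense in \<open>Y\<close>
  (\<open>zariski_closure_Gam_V\<close>), the pull-back is injective and every axiom on \<open>Y\<close> follows from the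
  axiom on \<open>V\<close> (\<open>induced_bracket_exists\<close>).

  The equations of motion are the Hamiltonian equations of \<open>H\<close> on \<open>V\<close>
  (\<open>motion_field_eq_dirac_field\<close>), and \<open>H\<close> is \<open>h \<circ> \<Gamma>\<close>.  Hence the derivative of a
  component of \<open>\<Gamma>\<close> along the motion is its bracket with \<open>H\<close>, which is the right-hand side of the
  reduced system (\<open>Gam_derivative_along_motion\<close>).

  The orbit of a point is a curve \<open>p + s a + s\<^sup>2 b\<close> with independent \<open>a\<close> and \<open>b\<close>, and any such
  curve is a parabola in the plane spanned by \<open>a\<close> and \<open>b\<close> through \<open>p\<close>
  (\<open>parabola_in_plane_quadratic_curve\<close>).
\<close>

section \<open>Directional derivatives of polynomial functions\<close>

lemma partial_deriv_eq_frechet: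
  assumes "(f has_derivative f') (at z)"
  shows "partial_deriv f b z = f' b"
proof -
  have "((\<lambda>t. z + t *\<^sub>R b) has_derivative (\<lambda>t. t *\<^sub>R b)) (at 0)"
    by (auto intro!: derivative_eq_intros)
  then have "((\<lambda>t. f (z + t *\<^sub>R b)) has_derivative (\<lambda>t. f' (t *\<^sub>R b))) (at 0)"
    using has_derivative_compose[of "\<lambda>t. z + t *\<^sub>R b" "\<lambda>t. t *\<^sub>R b" 0 UNIV f f'] assms by simp
  moreover have "f' (t *\<^sub>R b) = f' b * t" for t
    using has_derivative_linear[OF assms] by (simp add: linear_scale)
  ultimately have "((\<lambda>t. f (z + t *\<^sub>R b)) has_real_derivative f' b) (at 0)"
    by (simp add: has_field_derivative_def)
  then show ?thesis
    unfolding partial_deriv_def by (rule DERIV_imp_deriv)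
qed

lemma partial_deriv_const [simp]: "partial_deriv (\<lambda>u. a) b z = 0"
  by (rule partial_deriv_eq_frechet) (rule has_derivative_const)

lemma partial_deriv_bounded_linear: "bounded_linear f \<Longrightarrow> partial_deriv f b z = f b"
  by (rule partial_deriv_eq_frechet) (rule bounded_linear_imp_has_derivative)

lemma partial_deriv_add:
  assumes "f differentiable at z" "g differentiable at z"
  shows "partial_deriv (\<lambda>u. f u + g u) b z = partial_deriv f b z + partial_deriv g b z"
proof -
  obtain f' g' where "(f has_derivative f') (at z)" "(g has_derivative g') (at z)"
    using assms by (auto simp: differentiable_def)
  then show ?thesis
    using partial_deriv_eq_frechet[OF has_derivative_add, of f f' z g g' b]
    by (simp add: partial_deriv_eq_frechet)
qed

lemma partial_deriv_mult:
  fixes f g :: "'a::real_normed_vector \<Rightarrow> real"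
  assumes "f differentiable at z" "g differentiable at z"
  shows "partial_deriv (\<lambda>u. f u * g u) b z = f z * partial_deriv g b z + partial_deriv f b z * g z"
proof -
  obtain f' g' where "(f has_derivative f') (at z)" "(g has_derivative g') (at z)"
    using assms by (auto simp: differentiable_def)
  then show ?thesis
    using partial_deriv_eq_frechet[OF has_derivative_mult, of f f' z g g' b]
    by (simp add: partial_deriv_eq_frechet)
qed

lemma partial_deriv_sum_Basis:
  fixes v :: "'a::euclidean_space"
  assumes "f differentiable at z"
  shows "(\<Sum>b\<in>Basis. (v \<bullet> b) * partial_deriv f b z) = partial_deriv f v z"
proof -
  obtain f' where f': "(f has_derivative f') (at z)"
    using assms by (auto simp: differentiable_def)
  have "f' v = f' (\<Sum>b\<in>Basis. (v \<bullet> b) *\<^sub>R b)"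
    by (simp add: euclidean_representation)
  also have "\<dots> = (\<Sum>b\<in>Basis. (v \<bullet> b) * f' b)"
    using has_derivative_linear[OF f'] by (simp add: linear_sum linear_scale)
  finally show ?thesis
    by (simp add: partial_deriv_eq_frechet[OF f'])
qed

lemmas real_polynomial_function_linear = real_polynomial_function.intros(1)
lemmas real_polynomial_function_const = real_polynomial_function.intros(2)
lemmas real_polynomial_function_add = real_polynomial_function.intros(3)
lemmas real_polynomial_function_mult = real_polynomial_function.intros(4)

lemmas polynomial_intros = real_polynomial_function_const real_polynomial_function_add
  real_polynomial_function_mult real_polynomial_function_diff real_polynomial_function_minus
  real_polynomial_function_divide real_polynomial_function_power

lemma real_polynomial_function_partial_deriv:
  assumes "real_polynomial_function p"
  shows "real_polynomial_function (partial_deriv p b)"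
  using assms
proof (induction rule: real_polynomial_function.induct)
  case (linear f)
  then have "partial_deriv f b = (\<lambda>z. f b)"
    by (auto simp: partial_deriv_bounded_linear)
  then show ?case by (simp add: real_polynomial_function_const)
next
  case (const c)
  have "partial_deriv (\<lambda>x. c) b = (\<lambda>z. 0)" for c :: real by (rule ext) simp
  then show ?case by (simp add: real_polynomial_function_const)
next
  case (add f g)
  then have "partial_deriv (\<lambda>x. f x + g x) b = (\<lambda>z. partial_deriv f b z + partial_deriv g b z)"
    by (auto simp: partial_deriv_add differentiable_at_real_polynomial_function)
  with add show ?case by (simp add: real_polynomial_function_add)
next
  case (mult f g)
  then have "partial_deriv (\<lambda>x. f x * g x) b
      = (\<lambda>z. f z * partial_deriv g b z + partial_deriv f b z * g z)"
    by (auto simp: partial_deriv_mult differentiable_at_real_polynomial_function)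
  with mult show ?case by (simp add: polynomial_intros)
qed

lemma real_polynomial_function_inner: "real_polynomial_function (\<lambda>u. u \<bullet> b)"
  by (intro real_polynomial_function_linear bounded_linear_inner_left)

lemma partial_deriv_inner [simp]: "partial_deriv (\<lambda>u. u \<bullet> b) c z = c \<bullet> b"
  by (rule partial_deriv_bounded_linear) (rule bounded_linear_inner_left)

text \<open>A linear form is a finite combination of coordinates, so polynomial functions on a Euclidean
  space are generated, as an algebra, by the coordinates.\<close>

lemma real_polynomial_function_coord_induct [consumes 1, case_names const coord add mult]:
  fixes p :: "'a::euclidean_space \<Rightarrow> real"
  assumes p: "real_polynomial_function p"
    and const: "\<And>a. P (\<lambda>u. a)"
    and coord: "\<And>b. b \<in> Basis \<Longrightarrow> P (\<lambda>u. u \<bullet> b)"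
    and add: "\<And>p q. real_polynomial_function p \<Longrightarrow> P p \<Longrightarrow> real_polynomial_function q \<Longrightarrow> P q
                 \<Longrightarrow> P (\<lambda>u. p u + q u)"
    and mult: "\<And>p q. real_polynomial_function p \<Longrightarrow> P p \<Longrightarrow> real_polynomial_function q \<Longrightarrow> P q
                 \<Longrightarrow> P (\<lambda>u. p u * q u)"
  shows "P p"
  using p
proof (induction rule: real_polynomial_function.induct)
  case (linear f)
  have "real_polynomial_function (\<lambda>u. \<Sum>b\<in>S. f b * (u \<bullet> b)) \<and> P (\<lambda>u. \<Sum>b\<in>S. f b * (u \<bullet> b))"
    if "S \<subseteq> Basis" for S
    using finite_subset[OF that finite_Basis] that
  proof (induction S rule: finite_induct)
    case empty
    show ?case using const[of 0] by (simp add: real_polynomial_function_const)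
  next
    case (insert c S)
    have "P (\<lambda>u. f c * (u \<bullet> c))"
      using insert.prems by (intro mult const coord) (auto simp: real_polynomial_function_inner)
    moreover have "real_polynomial_function (\<lambda>u. f c * (u \<bullet> c))"
      by (intro real_polynomial_function_mult real_polynomial_function_const
            real_polynomial_function_inner)
    ultimately show ?case
      using insert by (auto intro!: add real_polynomial_function_add)
  qed
  from this[OF subset_refl] have "P (\<lambda>u. \<Sum>b\<in>Basis. f b * (u \<bullet> b))" ..
  moreover have "f u = (\<Sum>b\<in>Basis. f b * (u \<bullet> b))" for u
  proof -
    have "f u = f (\<Sum>b\<in>Basis. (u \<bullet> b) *\<^sub>R b)" by (simp add: euclidean_representation)
    also have "\<dots> = (\<Sum>b\<in>Basis. f b * (u \<bullet> b))"
      using bounded_linear.linear[OF linear] by (simp add: linear_sum linear_scale mult.commute)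
    finally show ?thesis .
  qed
  then have "f = (\<lambda>u. \<Sum>b\<in>Basis. f b * (u \<bullet> b))" by (rule ext)
  ultimately show ?case by metis
qed (auto intro: const add mult)

section \<open>Coordinate rings and skew biderivations\<close>

lemma coord_ringI: "real_polynomial_function p \<Longrightarrow> (\<lambda>u\<in>Z. p u) \<in> coord_ring Z"
  by (auto simp: coord_ring_def)

lemma coord_ringE:
  assumes "f \<in> coord_ring Z"
  obtains p where "real_polynomial_function p" "f = (\<lambda>u\<in>Z. p u)"
  using assms by (auto simp: coord_ring_def)

lemma coord_ring_const: "(\<lambda>u\<in>Z. a) \<in> coord_ring Z"
  by (rule coord_ringI) (rule real_polynomial_function_const)

lemma coord_ring_coord: "(\<lambda>u\<in>Z. u \<bullet> b) \<in> coord_ring Z"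
  by (rule coord_ringI) (rule real_polynomial_function_inner)

lemma coord_ring_lincomb:
  assumes "f \<in> coord_ring Z" "g \<in> coord_ring Z"
  shows "(\<lambda>u\<in>Z. a * f u + b * g u) \<in> coord_ring Z"
proof -
  obtain p q where "real_polynomial_function p" "f = (\<lambda>u\<in>Z. p u)"
      "real_polynomial_function q" "g = (\<lambda>u\<in>Z. q u)"
    using assms by (metis coord_ringE)
  moreover from this have "(\<lambda>u\<in>Z. a * f u + b * g u) = (\<lambda>u\<in>Z. a * p u + b * q u)"
    by (auto simp: restrict_def)
  ultimately show ?thesis
    by (simp add: coord_ringI polynomial_intros)
qed

lemma coord_ring_add:
  "f \<in> coord_ring Z \<Longrightarrow> g \<in> coord_ring Z \<Longrightarrow> (\<lambda>u\<in>Z. f u + g u) \<in> coord_ring Z"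
  using coord_ring_lincomb[of f Z g 1 1] by simp

lemma coord_ring_mult:
  assumes "f \<in> coord_ring Z" "g \<in> coord_ring Z"
  shows "(\<lambda>u\<in>Z. f u * g u) \<in> coord_ring Z"
proof -
  obtain p q where "real_polynomial_function p" "f = (\<lambda>u\<in>Z. p u)"
      "real_polynomial_function q" "g = (\<lambda>u\<in>Z. q u)"
    using assms by (metis coord_ringE)
  moreover from this have "(\<lambda>u\<in>Z. f u * g u) = (\<lambda>u\<in>Z. p u * q u)"
    by (auto simp: restrict_def)
  ultimately show ?thesis
    by (simp add: coord_ringI polynomial_intros)
qed

lemma coord_ring_eqI:
  assumes "f \<in> coord_ring Z" "g \<in> coord_ring Z" "\<And>z. z \<in> Z \<Longrightarrow> f z = g z"
  shows "f = g"
  using assms by (auto elim!: coord_ringE simp: fun_eq_iff)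

lemma coord_ring_induct [consumes 1, case_names const coord add mult]:
  fixes f :: "'a::euclidean_space \<Rightarrow> real"
  assumes f: "f \<in> coord_ring Z"
    and const: "\<And>a. P (\<lambda>u\<in>Z. a)"
    and coord: "\<And>b. b \<in> Basis \<Longrightarrow> P (\<lambda>u\<in>Z. u \<bullet> b)"
    and add: "\<And>f g. f \<in> coord_ring Z \<Longrightarrow> P f \<Longrightarrow> g \<in> coord_ring Z \<Longrightarrow> P g
                 \<Longrightarrow> P (\<lambda>u\<in>Z. f u + g u)"
    and mult: "\<And>f g. f \<in> coord_ring Z \<Longrightarrow> P f \<Longrightarrow> g \<in> coord_ring Z \<Longrightarrow> P g
                 \<Longrightarrow> P (\<lambda>u\<in>Z. f u * g u)"
  shows "P f"
proof -
  obtain p where p: "real_polynomial_function p" and "f = (\<lambda>u\<in>Z. p u)"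
    using f by (rule coord_ringE)
  from p have "P (\<lambda>u\<in>Z. p u)"
  proof (induction rule: real_polynomial_function_coord_induct)
    case (add p q)
    then have "P (\<lambda>u\<in>Z. (\<lambda>u\<in>Z. p u) u + (\<lambda>u\<in>Z. q u) u)"
      by (intro assms(4) coord_ringI)
    moreover have "(\<lambda>u\<in>Z. (\<lambda>u\<in>Z. p u) u + (\<lambda>u\<in>Z. q u) u) = (\<lambda>u\<in>Z. p u + q u)"
      by (auto simp: restrict_def)
    ultimately show ?case by (simp only:)
  next
    case (mult p q)
    then have "P (\<lambda>u\<in>Z. (\<lambda>u\<in>Z. p u) u * (\<lambda>u\<in>Z. q u) u)"
      by (intro assms(5) coord_ringI)
    moreover have "(\<lambda>u\<in>Z. (\<lambda>u\<in>Z. p u) u * (\<lambda>u\<in>Z. q u) u) = (\<lambda>u\<in>Z. p u * q u)"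
      by (auto simp: restrict_def)
    ultimately show ?case by (simp only:)
  qed (rule const coord; assumption?)+
  then show ?thesis by (simp add: \<open>f = _\<close>)
qed

text \<open>The axioms of a Poisson bracket without the Jacobi identity.  They suffice for the chain rule,
  and the Jacobi identity is derived from them and finitely many instances.\<close>

definition skew_biderivation :: "'a::real_normed_vector set \<Rightarrow> 'a bracket \<Rightarrow> bool" where
  "skew_biderivation Z B \<longleftrightarrow>
     (\<forall>f\<in>coord_ring Z. \<forall>g\<in>coord_ring Z. B f g \<in> coord_ring Z) \<and>
     (\<forall>f\<in>coord_ring Z. \<forall>g\<in>coord_ring Z. \<forall>z\<in>Z. B f g z = - B g f z) \<and>
     (\<forall>f\<in>coord_ring Z. \<forall>g\<in>coord_ring Z. \<forall>k\<in>coord_ring Z. \<forall>a b. \<forall>z\<in>Z.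
        B (\<lambda>u\<in>Z. a * f u + b * g u) k z = a * B f k z + b * B g k z) \<and>
     (\<forall>f\<in>coord_ring Z. \<forall>g\<in>coord_ring Z. \<forall>k\<in>coord_ring Z. \<forall>z\<in>Z.
        B (\<lambda>u\<in>Z. f u * g u) k z = f z * B g k z + B f k z * g z)"

lemma bracket_ext_add:
  "f differentiable at z \<Longrightarrow> g differentiable at z \<Longrightarrow>
    bracket_ext Z B k (\<lambda>u. f u + g u) z = bracket_ext Z B k f z + bracket_ext Z B k g z"
  unfolding bracket_ext_def by (simp only: partial_deriv_add distrib_left sum.distrib)

lemma bracket_ext_mult:
  fixes f g :: "'a::euclidean_space \<Rightarrow> real"
  assumes "f differentiable at z" "g differentiable at z"
  shows "bracket_ext Z B k (\<lambda>u. f u * g u) z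
    = f z * bracket_ext Z B k g z + bracket_ext Z B k f z * g z"
proof -
  have "B k (\<lambda>u\<in>Z. u \<bullet> b) z * partial_deriv (\<lambda>u. f u * g u) b z
      = f z * (B k (\<lambda>u\<in>Z. u \<bullet> b) z * partial_deriv g b z)
      + (B k (\<lambda>u\<in>Z. u \<bullet> b) z * partial_deriv f b z) * g z" for b
    unfolding partial_deriv_mult[OF assms] by (simp only: distrib_left mult_ac)
  then show ?thesis
    unfolding bracket_ext_def by (simp only: sum.distrib sum_distrib_left sum_distrib_right)
qed

lemma poisson_bracket_iff:
  "poisson_bracket Z B \<longleftrightarrow> skew_biderivation Z B \<and>
     (\<forall>f\<in>coord_ring Z. \<forall>g\<in>coord_ring Z. \<forall>k\<in>coord_ring Z. \<forall>z\<in>Z.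
        B f (B g k) z + B g (B k f) z + B k (B f g) z = 0)"
  unfolding poisson_bracket_def skew_biderivation_def by (simp only: conj_assoc)

context
  fixes Z :: "'a::euclidean_space set" and B :: "'a bracket"
  assumes B: "skew_biderivation Z B"
begin

lemma biderivation_closed: "f \<in> coord_ring Z \<Longrightarrow> g \<in> coord_ring Z \<Longrightarrow> B f g \<in> coord_ring Z"
  using B unfolding skew_biderivation_def by blast

lemma biderivation_skew:
  "f \<in> coord_ring Z \<Longrightarrow> g \<in> coord_ring Z \<Longrightarrow> z \<in> Z \<Longrightarrow> B f g z = - B g f z"
  using B unfolding skew_biderivation_def by blast

lemma biderivation_self: "f \<in> coord_ring Z \<Longrightarrow> z \<in> Z \<Longrightarrow> B f f z = 0"
  using biderivation_skew[of f f z] by simp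

lemma biderivation_lincomb_left:
  "f \<in> coord_ring Z \<Longrightarrow> g \<in> coord_ring Z \<Longrightarrow> k \<in> coord_ring Z \<Longrightarrow> z \<in> Z \<Longrightarrow>
     B (\<lambda>u\<in>Z. a * f u + b * g u) k z = a * B f k z + b * B g k z"
  using B unfolding skew_biderivation_def by blast

lemma biderivation_add_left:
  "f \<in> coord_ring Z \<Longrightarrow> g \<in> coord_ring Z \<Longrightarrow> k \<in> coord_ring Z \<Longrightarrow> z \<in> Z \<Longrightarrow>
     B (\<lambda>u\<in>Z. f u + g u) k z = B f k z + B g k z"
  using biderivation_lincomb_left[of f g k z 1 1] by simp

lemma biderivation_mult_left:
  "f \<in> coord_ring Z \<Longrightarrow> g \<in> coord_ring Z \<Longrightarrow> k \<in> coord_ring Z \<Longrightarrow> z \<in> Z \<Longrightarrow>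
     B (\<lambda>u\<in>Z. f u * g u) k z = f z * B g k z + B f k z * g z"
  using B unfolding skew_biderivation_def by blast

lemma biderivation_const_left:
  assumes k: "k \<in> coord_ring Z" and z: "z \<in> Z"
  shows "B (\<lambda>u\<in>Z. a) k z = 0"
proof -
  let ?one = "\<lambda>u\<in>Z. 1::real"
  have one: "?one \<in> coord_ring Z" by (rule coord_ring_const)
  have "(\<lambda>u\<in>Z. ?one u * ?one u) = ?one" by (auto simp: restrict_def)
  then have "B ?one k z = 0"
    using biderivation_mult_left[OF one one k z] z by simp
  moreover have "(\<lambda>u\<in>Z. a * ?one u + 0 * ?one u) = (\<lambda>u\<in>Z. a)" by (auto simp: restrict_def)
  ultimately show ?thesis
    using biderivation_lincomb_left[OF one one k z, of a 0] by simp
qed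

lemma biderivation_add_right:
  "f \<in> coord_ring Z \<Longrightarrow> g \<in> coord_ring Z \<Longrightarrow> k \<in> coord_ring Z \<Longrightarrow> z \<in> Z \<Longrightarrow>
     B k (\<lambda>u\<in>Z. f u + g u) z = B k f z + B k g z"
  using biderivation_skew[of k "\<lambda>u\<in>Z. f u + g u" z] biderivation_skew[of k f z]
    biderivation_skew[of k g z] biderivation_add_left[of f g k z] coord_ring_add[of f Z g]
  by simp

lemma biderivation_mult_right:
  assumes "f \<in> coord_ring Z" "g \<in> coord_ring Z" "k \<in> coord_ring Z" "z \<in> Z"
  shows "B k (\<lambda>u\<in>Z. f u * g u) z = f z * B k g z + B k f z * g z"
  using biderivation_skew[OF assms(3) coord_ring_mult[OF assms(1,2)] assms(4)]
    biderivation_skew[OF assms(3,1,4)] biderivation_skew[OF assms(3,2,4)]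
    biderivation_mult_left[OF assms]
  by simp

lemma biderivation_const_right:
  "k \<in> coord_ring Z \<Longrightarrow> z \<in> Z \<Longrightarrow> B k (\<lambda>u\<in>Z. a) z = 0"
  using biderivation_skew[of k "\<lambda>u\<in>Z. a" z] biderivation_const_left[of k z a]
    coord_ring_const[of a Z] by simp

text \<open>A derivation is determined by its values on generators; hence on polynomials the extension
  by the chain rule is the bracket itself.\<close>

lemma biderivation_eq_bracket_ext:
  assumes f: "f \<in> coord_ring Z" and p: "real_polynomial_function p" and z: "z \<in> Z"
  shows "B f (\<lambda>u\<in>Z. p u) z = bracket_ext Z B f p z"
  using p
proof (induction rule: real_polynomial_function_coord_induct)
  case (const a)
  then show ?case using biderivation_const_right[OF f z, of a]
    by (simp add: bracket_ext_def del: restrict_apply)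
next
  case (coord b)
  have "bracket_ext Z B f (\<lambda>u. u \<bullet> b) z
      = (\<Sum>c\<in>Basis. if c = b then B f (\<lambda>u\<in>Z. u \<bullet> c) z else 0)"
    unfolding bracket_ext_def partial_deriv_inner
    by (rule sum.cong) (auto simp: inner_Basis coord)
  then show ?case using coord by (simp del: restrict_apply)
next
  case (add p q)
  have "(\<lambda>u\<in>Z. p u + q u) = (\<lambda>u\<in>Z. (\<lambda>u\<in>Z. p u) u + (\<lambda>u\<in>Z. q u) u)"
    by (auto simp: restrict_def)
  then have "B f (\<lambda>u\<in>Z. p u + q u) z = B f (\<lambda>u\<in>Z. p u) z + B f (\<lambda>u\<in>Z. q u) z"
    using add f z by (simp only: biderivation_add_right coord_ringI)
  also have "\<dots> = bracket_ext Z B f (\<lambda>u. p u + q u) z"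
    unfolding add.IH
    by (rule bracket_ext_add[symmetric])
       (rule differentiable_at_real_polynomial_function, rule add.hyps)+
  finally show ?case .
next
  case (mult p q)
  have "(\<lambda>u\<in>Z. p u * q u) = (\<lambda>u\<in>Z. (\<lambda>u\<in>Z. p u) u * (\<lambda>u\<in>Z. q u) u)"
    by (auto simp: restrict_def)
  then have "B f (\<lambda>u\<in>Z. p u * q u) z
      = (\<lambda>u\<in>Z. p u) z * B f (\<lambda>u\<in>Z. q u) z + B f (\<lambda>u\<in>Z. p u) z * (\<lambda>u\<in>Z. q u) z"
    using mult f z by (simp only: biderivation_mult_right coord_ringI)
  then have "B f (\<lambda>u\<in>Z. p u * q u) z = p z * B f (\<lambda>u\<in>Z. q u) z + B f (\<lambda>u\<in>Z. p u) z * q z"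
    using z by (simp only: restrict_apply')
  also have "\<dots> = bracket_ext Z B f (\<lambda>u. p u * q u) z"
    unfolding mult.IH
    by (rule bracket_ext_mult[symmetric])
       (rule differentiable_at_real_polynomial_function, rule mult.hyps)+
  finally show ?case .
qed

text \<open>For a skew biderivation the Jacobiator is, in each argument, a derivation: the terms with
  two simple brackets cancel by skew-symmetry.  So it vanishes once it vanishes on coordinates;
  cyclic invariance moves the argument under induction to the last place.\<close>

lemma poisson_bracket_if_jacobi_on_coords:
  assumes jacobi: "\<And>b c d z. b \<in> Basis \<Longrightarrow> c \<in> Basis \<Longrightarrow> d \<in> Basis \<Longrightarrow> z \<in> Z \<Longrightarrow>
      B (\<lambda>u\<in>Z. u \<bullet> b) (B (\<lambda>u\<in>Z. u \<bullet> c) (\<lambda>u\<in>Z. u \<bullet> d)) z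
    + B (\<lambda>u\<in>Z. u \<bullet> c) (B (\<lambda>u\<in>Z. u \<bullet> d) (\<lambda>u\<in>Z. u \<bullet> b)) z
    + B (\<lambda>u\<in>Z. u \<bullet> d) (B (\<lambda>u\<in>Z. u \<bullet> b) (\<lambda>u\<in>Z. u \<bullet> c)) z = 0"
  shows "poisson_bracket Z B"
proof -
  define J where "J f g k z = B f (B g k) z + B g (B k f) z + B k (B f g) z" for f g k z
  note closed = biderivation_closed coord_ring_add coord_ring_mult
  have cyclic: "J f g k z = J g k f z" for f g k z
    by (simp add: J_def)
  have J_const: "J f g (\<lambda>u\<in>Z. a) z = 0"
    if [simp]: "f \<in> coord_ring Z" "g \<in> coord_ring Z" "z \<in> Z" for f g a z
  proof -
    have [simp]: "B g (\<lambda>u\<in>Z. a) = (\<lambda>u\<in>Z. 0)" "B (\<lambda>u\<in>Z. a) f = (\<lambda>u\<in>Z. 0)"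
      by (rule coord_ring_eqI[of _ Z];
          simp add: biderivation_closed coord_ring_const biderivation_const_right
            biderivation_const_left)+
    show ?thesis
      by (simp add: J_def biderivation_const_right biderivation_const_left biderivation_closed)
  qed
  have J_add: "J f g (\<lambda>u\<in>Z. k u + l u) z = J f g k z + J f g l z"
    if [simp]: "f \<in> coord_ring Z" "g \<in> coord_ring Z" "k \<in> coord_ring Z" "l \<in> coord_ring Z" "z \<in> Z"
    for f g k l z
  proof -
    have [simp]: "B g (\<lambda>u\<in>Z. k u + l u) = (\<lambda>u\<in>Z. B g k u + B g l u)"
        "B (\<lambda>u\<in>Z. k u + l u) f = (\<lambda>u\<in>Z. B k f u + B l f u)"
      by (rule coord_ring_eqI[of _ Z];
          simp add: closed biderivation_add_right biderivation_add_left)+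
    show ?thesis
      by (simp add: J_def biderivation_add_right biderivation_add_left closed)
  qed
  have J_mult: "J f g (\<lambda>u\<in>Z. k u * l u) z = k z * J f g l z + l z * J f g k z"
    if [simp]: "f \<in> coord_ring Z" "g \<in> coord_ring Z" "k \<in> coord_ring Z" "l \<in> coord_ring Z" "z \<in> Z"
    for f g k l z
  proof -
    have eq: "B g (\<lambda>u\<in>Z. k u * l u)
          = (\<lambda>u\<in>Z. (\<lambda>u\<in>Z. k u * B g l u) u + (\<lambda>u\<in>Z. B g k u * l u) u)"
        "B (\<lambda>u\<in>Z. k u * l u) f
          = (\<lambda>u\<in>Z. (\<lambda>u\<in>Z. k u * B l f u) u + (\<lambda>u\<in>Z. B k f u * l u) u)"
      by (rule coord_ring_eqI[of _ Z];
          simp add: closed biderivation_mult_right biderivation_mult_left del: restrict_apply;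
          simp)+
    have skew: "B k f z = - B f k z" "B l f z = - B f l z"
      by (rule biderivation_skew; fact)+
    show ?thesis
      unfolding J_def eq
      by (simp only: that closed biderivation_add_right biderivation_mult_right
            biderivation_mult_left skew) (simp add: skew algebra_simps)
  qed
  have J_extend: "J f g k z = 0"
    if "f \<in> coord_ring Z" "g \<in> coord_ring Z" "k \<in> coord_ring Z" "z \<in> Z"
      and "\<And>b. b \<in> Basis \<Longrightarrow> J f g (\<lambda>u\<in>Z. u \<bullet> b) z = 0" for f g k z
    using that(3)
    by (induction rule: coord_ring_induct)
       (use that in \<open>simp_all add: J_const J_add J_mult del: restrict_apply\<close>)
  have J1: "J (\<lambda>u\<in>Z. u \<bullet> b) (\<lambda>u\<in>Z. u \<bullet> c) k z = 0"
    if "b \<in> Basis" "c \<in> Basis" "k \<in> coord_ring Z" "z \<in> Z" for b c k z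
    by (rule J_extend) (use that jacobi in \<open>auto simp: J_def coord_ring_coord simp del: restrict_apply\<close>)
  have J2: "J k (\<lambda>u\<in>Z. u \<bullet> b) g z = 0"
    if "b \<in> Basis" "k \<in> coord_ring Z" "g \<in> coord_ring Z" "z \<in> Z" for b k g z
    by (rule J_extend) (use that J1 cyclic in \<open>metis coord_ring_coord\<close>)+
  have "J f g k z = 0"
    if "f \<in> coord_ring Z" "g \<in> coord_ring Z" "k \<in> coord_ring Z" "z \<in> Z" for f g k z
    by (rule J_extend) (use that J2 cyclic in \<open>metis\<close>)+
  then show ?thesis
    by (simp add: poisson_bracket_iff B J_def)
qed

end

section \<open>Existence of Poisson brackets\<close>

text \<open>\<open>X b\<close> is to be the Hamiltonian vector field of the coordinate \<open>u \<mapsto> u \<bullet> b\<close>.  The formula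
  \<open>{p, q} = \<Sum>\<^sub>b \<partial>\<^sub>b p \<sqdot> X b (q)\<close> defines a bracket of polynomials on the ambient space.  Tangency
  says that it vanishes on \<open>Z\<close> as soon as \<open>q\<close> does; by skew-symmetry the same holds for \<open>p\<close>, so it
  descends to restrictions.  The Jacobi identity is required only for coordinates, where it is a
  condition on the fields.\<close>

lemma poisson_bracket_from_hamiltonian_fields:
  fixes X :: "'a::euclidean_space \<Rightarrow> 'a \<Rightarrow> 'a"
  assumes poly: "\<And>b c. b \<in> Basis \<Longrightarrow> c \<in> Basis \<Longrightarrow> real_polynomial_function (\<lambda>z. X b z \<bullet> c)"
    and skew: "\<And>b c z. b \<in> Basis \<Longrightarrow> c \<in> Basis \<Longrightarrow> z \<in> Z \<Longrightarrow> X b z \<bullet> c = - (X c z \<bullet> b)"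
    and tangent: "\<And>p b z. real_polynomial_function p \<Longrightarrow> (\<And>u. u \<in> Z \<Longrightarrow> p u = 0) \<Longrightarrow>
      b \<in> Basis \<Longrightarrow> z \<in> Z \<Longrightarrow> partial_deriv p (X b z) z = 0"
    and jacobi: "\<And>b c d z. b \<in> Basis \<Longrightarrow> c \<in> Basis \<Longrightarrow> d \<in> Basis \<Longrightarrow> z \<in> Z \<Longrightarrow>
      partial_deriv (\<lambda>u. X c u \<bullet> d) (X b z) z + partial_deriv (\<lambda>u. X d u \<bullet> b) (X c z) z
      + partial_deriv (\<lambda>u. X b u \<bullet> c) (X d z) z = 0"
  shows "\<exists>B. poisson_bracket Z B \<and>
    (\<forall>b\<in>Basis. \<forall>c\<in>Basis. \<forall>z\<in>Z. B (\<lambda>u\<in>Z. u \<bullet> b) (\<lambda>u\<in>Z. u \<bullet> c) z = X b z \<bullet> c)"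
proof -
  define \<pi> where "\<pi> p q z = (\<Sum>b\<in>Basis. partial_deriv p b z * partial_deriv q (X b z) z)" for p q z
  have \<pi>_expand: "\<pi> p q z
      = (\<Sum>b\<in>Basis. \<Sum>c\<in>Basis. partial_deriv p b z * ((X b z \<bullet> c) * partial_deriv q c z))"
    if "real_polynomial_function q" for p q z
  proof -
    have "partial_deriv q (X b z) z = (\<Sum>c\<in>Basis. (X b z \<bullet> c) * partial_deriv q c z)" for b
      by (rule partial_deriv_sum_Basis[symmetric]) (rule differentiable_at_real_polynomial_function[OF that])
    then show ?thesis
      unfolding \<pi>_def by (simp only: sum_distrib_left)
  qed
  have \<pi>_poly: "real_polynomial_function (\<pi> p q)"
    if "real_polynomial_function p" "real_polynomial_function q" for p q
  proof -
    have "real_polynomial_function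
       (\<lambda>z. \<Sum>b\<in>Basis. \<Sum>c\<in>Basis. partial_deriv p b z * ((X b z \<bullet> c) * partial_deriv q c z))"
      by (intro real_polynomial_function_sum polynomial_intros finite_Basis poly
          real_polynomial_function_partial_deriv that)
    moreover have "\<pi> p q = (\<lambda>z. \<Sum>b\<in>Basis. \<Sum>c\<in>Basis.
        partial_deriv p b z * ((X b z \<bullet> c) * partial_deriv q c z))"
      by (rule ext) (rule \<pi>_expand[OF that(2)])
    ultimately show ?thesis by (simp only:)
  qed
  have \<pi>_skew: "\<pi> p q z = - \<pi> q p z"
    if "real_polynomial_function p" "real_polynomial_function q" "z \<in> Z" for p q z
  proof -
    have "\<pi> p q z = (\<Sum>c\<in>Basis. \<Sum>b\<in>Basis. partial_deriv p b z * ((X b z \<bullet> c) * partial_deriv q c z))"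
      unfolding \<pi>_expand[OF that(2)] by (rule sum.swap)
    also have "\<dots> = (\<Sum>c\<in>Basis. \<Sum>b\<in>Basis.
        - (partial_deriv q c z * ((X c z \<bullet> b) * partial_deriv p b z)))"
    proof (intro sum.cong refl)
      fix b c :: 'a assume bc: "b \<in> Basis" "c \<in> Basis"
      show "partial_deriv p b z * ((X b z \<bullet> c) * partial_deriv q c z)
          = - (partial_deriv q c z * ((X c z \<bullet> b) * partial_deriv p b z))"
        unfolding skew[OF bc that(3)] by simp
    qed
    also have "\<dots> = - \<pi> q p z"
      unfolding \<pi>_expand[OF that(1)] by (simp add: sum_negf)
    finally show ?thesis .
  qed
  have \<pi>_lincomb: "\<pi> (\<lambda>u. a * p u + b * p' u) q z = a * \<pi> p q z + b * \<pi> p' q z"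
    if "real_polynomial_function p" "real_polynomial_function p'" for a b p p' q z
  proof -
    have "partial_deriv (\<lambda>u. a * p u + b * p' u) v z
        = a * partial_deriv p v z + b * partial_deriv p' v z" for v
      using that
      by (simp add: partial_deriv_add partial_deriv_mult differentiable_at_real_polynomial_function
          polynomial_intros)
    then show ?thesis
      by (simp add: \<pi>_def algebra_simps sum.distrib sum_distrib_left)
  qed
  have \<pi>_mult: "\<pi> (\<lambda>u. p u * p' u) q z = p z * \<pi> p' q z + \<pi> p q z * p' z"
    if "real_polynomial_function p" "real_polynomial_function p'" for p p' q z
    using that
    by (simp add: \<pi>_def partial_deriv_mult differentiable_at_real_polynomial_function
        algebra_simps sum.distrib sum_distrib_left)
  have \<pi>_vanish: "\<pi> p q z = 0"
    if "real_polynomial_function q" "\<And>u. u \<in> Z \<Longrightarrow> q u = 0" "z \<in> Z" for p q z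
    using that tangent by (simp add: \<pi>_def)
  have \<pi>_cong_left: "\<pi> p q z = \<pi> p' q z"
    if p: "real_polynomial_function p" "real_polynomial_function p'" "real_polynomial_function q"
      and eq: "\<And>u. u \<in> Z \<Longrightarrow> p u = p' u" and z: "z \<in> Z" for p p' q z
  proof -
    \<comment> \<open>The difference, written as a linear combination to match the rule for these.\<close>
    let ?d = "\<lambda>u. 1 * p u + (-1) * p' u"
    have d: "real_polynomial_function ?d"
      by (intro polynomial_intros p)
    have "\<pi> q ?d z = 0"
      by (rule \<pi>_vanish[OF d]) (simp_all add: eq z)
    then have "\<pi> ?d q z = 0"
      using \<pi>_skew[OF d p(3) z] by linarith
    then show ?thesis
      unfolding \<pi>_lincomb[OF p(1,2)] by simp
  qed
  \<comment> \<open>An element of the coordinate ring has many polynomial representatives; by the congruence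
    above any choice gives the same bracket on \<open>Z\<close>.\<close>
  define rep where "rep f = (SOME p. real_polynomial_function p \<and> f = (\<lambda>u\<in>Z. p u))" for f
  define B where "B f g = (\<lambda>z\<in>Z. \<pi> (rep f) (rep g) z)" for f g
  have rep: "real_polynomial_function (rep (\<lambda>u\<in>Z. p u))" "z \<in> Z \<Longrightarrow> rep (\<lambda>u\<in>Z. p u) z = p z"
    if "real_polynomial_function p" for p z
  proof -
    have *: "real_polynomial_function (rep (\<lambda>u\<in>Z. p u)) \<and> (\<lambda>u\<in>Z. p u) = (\<lambda>u\<in>Z. rep (\<lambda>u\<in>Z. p u) u)"
      unfolding rep_def by (rule someI[of _ p]) (simp add: that)
    from * show "real_polynomial_function (rep (\<lambda>u\<in>Z. p u))" ..
    show "rep (\<lambda>u\<in>Z. p u) z = p z" if "z \<in> Z"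
      using * that by (metis restrict_apply')
  qed
  have B_eq: "B (\<lambda>u\<in>Z. p u) (\<lambda>u\<in>Z. q u) = (\<lambda>z\<in>Z. \<pi> p q z)"
    if "real_polynomial_function p" "real_polynomial_function q" for p q
    unfolding B_def
  proof (rule restrict_ext)
    fix z assume z: "z \<in> Z"
    let ?p = "rep (\<lambda>u\<in>Z. p u)" and ?q = "rep (\<lambda>u\<in>Z. q u)"
    note r = rep(1)[OF that(1)] rep(1)[OF that(2)]
    have "\<pi> ?p ?q z = \<pi> p ?q z"
      by (rule \<pi>_cong_left) (use that r z in \<open>auto simp: rep(2)\<close>)
    also have "\<dots> = - \<pi> ?q p z"
      by (rule \<pi>_skew) (use that r z in auto)
    also have "\<pi> ?q p z = \<pi> q p z"
      by (rule \<pi>_cong_left) (use that r z in \<open>auto simp: rep(2)\<close>)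
    also have "- \<pi> q p z = \<pi> p q z"
      using \<pi>_skew[OF that z] by simp
    finally show "\<pi> ?p ?q z = \<pi> p q z" .
  qed
  have biderivation: "skew_biderivation Z B"
    unfolding skew_biderivation_def
  proof (intro conjI ballI allI)
    fix f g assume "f \<in> coord_ring Z" "g \<in> coord_ring Z"
    then obtain p q where [simp]: "f = (\<lambda>u\<in>Z. p u)" "g = (\<lambda>u\<in>Z. q u)"
      and p: "real_polynomial_function p" "real_polynomial_function q"
      by (metis coord_ringE)
    show "B f g \<in> coord_ring Z"
      by (simp only: \<open>f = _\<close> \<open>g = _\<close> B_eq[OF p] coord_ringI[OF \<pi>_poly[OF p]])
    fix z assume z: "z \<in> Z"
    show "B f g z = - B g f z"
      using \<pi>_skew[OF p z] z by (simp only: \<open>f = _\<close> \<open>g = _\<close> B_eq p restrict_apply')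
    fix k assume "k \<in> coord_ring Z"
    then obtain r where "k = (\<lambda>u\<in>Z. r u)" and r: "real_polynomial_function r"
      by (rule coord_ringE)
    have "(\<lambda>u\<in>Z. f u * g u) = (\<lambda>u\<in>Z. p u * q u)"
      by (rule restrict_ext) simp
    then show "B (\<lambda>u\<in>Z. f u * g u) k z = f z * B g k z + B f k z * g z"
      using z by (simp only: \<open>f = _\<close> \<open>g = _\<close> \<open>k = _\<close> B_eq p r polynomial_intros \<pi>_mult restrict_apply')
    fix a b :: real
    have "(\<lambda>u\<in>Z. a * f u + b * g u) = (\<lambda>u\<in>Z. a * p u + b * q u)"
      by (rule restrict_ext) simp
    then show "B (\<lambda>u\<in>Z. a * f u + b * g u) k z = a * B f k z + b * B g k z"
      using z by (simp only: \<open>f = _\<close> \<open>g = _\<close> \<open>k = _\<close> B_eq p r polynomial_intros \<pi>_lincomb restrict_apply')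
  qed
  have B_coord: "B (\<lambda>u\<in>Z. u \<bullet> b) (\<lambda>u\<in>Z. q u) = (\<lambda>z\<in>Z. partial_deriv q (X b z) z)"
    if "b \<in> Basis" "real_polynomial_function q" for b q
  proof -
    have "\<pi> (\<lambda>u. u \<bullet> b) q z = partial_deriv q (X b z) z" for z
    proof -
      have "\<pi> (\<lambda>u. u \<bullet> b) q z = (\<Sum>c\<in>Basis. if c = b then partial_deriv q (X c z) z else 0)"
        unfolding \<pi>_def partial_deriv_inner
        by (rule sum.cong) (auto simp: inner_Basis that)
      then show ?thesis using that by simp
    qed
    then show ?thesis
      by (simp only: B_eq real_polynomial_function_inner that)
  qed
  have B_coord2: "B (\<lambda>u\<in>Z. u \<bullet> b) (\<lambda>u\<in>Z. u \<bullet> c) = (\<lambda>z\<in>Z. X b z \<bullet> c)"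
    if "b \<in> Basis" for b c
    by (simp only: B_coord[OF that real_polynomial_function_inner] partial_deriv_inner)
  have "poisson_bracket Z B"
    by (rule poisson_bracket_if_jacobi_on_coords[OF biderivation])
       (simp only: B_coord2 B_coord poly restrict_apply' jacobi)
  then show ?thesis
    using B_coord2 by (intro exI[of _ B]) simp
qed

text \<open>By the Leibniz rule the functions pulled back from \<open>Z\<close> are closed under the bracket of \<open>X\<close> if
  this holds for brackets of pulled back coordinates.  Since the image of \<open>\<Gamma>\<close> is Zariski dense,
  pulling back is injective: the bracket on \<open>Z\<close> is determined, and every identity that defines a
  Poisson bracket can be checked after pulling back, where it holds for \<open>B\<close>.\<close>

lemma induced_bracket_exists:
  fixes \<Gamma> :: "'a::euclidean_space \<Rightarrow> 'b::euclidean_space"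
  assumes B: "poisson_bracket X B"
    and \<Gamma>: "polynomial_function \<Gamma>" "\<Gamma> ` X \<subseteq> Z" "Z \<subseteq> zariski_closure (\<Gamma> ` X)"
    and gen: "\<And>b c. b \<in> Basis \<Longrightarrow> c \<in> Basis \<Longrightarrow>
      \<exists>r\<in>coord_ring Z. \<forall>u\<in>X. B (\<lambda>u\<in>X. \<Gamma> u \<bullet> b) (\<lambda>u\<in>X. \<Gamma> u \<bullet> c) u = r (\<Gamma> u)"
  shows "\<exists>B'. induces_bracket \<Gamma> X B Z B'"
proof -
  have D: "skew_biderivation X B"
    using B unfolding poisson_bracket_iff by (rule conjunct1)
  define pull where "pull \<phi> = (\<lambda>u\<in>X. \<phi> (\<Gamma> u))" for \<phi> :: "'b \<Rightarrow> real"
  have pull_ring: "pull \<phi> \<in> coord_ring X" if \<phi>: "\<phi> \<in> coord_ring Z" for \<phi>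
  proof -
    obtain p where p: "real_polynomial_function p" "\<phi> = (\<lambda>u\<in>Z. p u)"
      using \<phi> by (rule coord_ringE)
    have "pull \<phi> = (\<lambda>u\<in>X. (p \<circ> \<Gamma>) u)"
      unfolding pull_def by (rule restrict_ext) (use p \<Gamma>(2) in auto)
    then show ?thesis
      using coord_ringI[OF real_polynomial_function_compose[OF \<Gamma>(1) p(1)]] by simp
  qed
  have \<Gamma>_in: "\<Gamma> u \<in> Z" if "u \<in> X" for u
    using \<Gamma>(2) that by blast
  have pull_apply: "pull \<phi> u = \<phi> (\<Gamma> u)" if "u \<in> X" for \<phi> u
    using that by (simp add: pull_def)
  have pull_const: "pull (\<lambda>w\<in>Z. a) = (\<lambda>u\<in>X. a)" for a
    unfolding pull_def by (rule restrict_ext) (use \<Gamma>(2) in auto)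
  have pull_coord: "pull (\<lambda>w\<in>Z. w \<bullet> b) = (\<lambda>u\<in>X. \<Gamma> u \<bullet> b)" for b
    unfolding pull_def by (rule restrict_ext) (use \<Gamma>(2) in auto)
  have pull_add: "pull (\<lambda>w\<in>Z. \<phi> w + \<psi> w) = (\<lambda>u\<in>X. pull \<phi> u + pull \<psi> u)" for \<phi> \<psi>
    unfolding pull_def by (rule restrict_ext) (use \<Gamma>(2) in auto)
  have pull_mult: "pull (\<lambda>w\<in>Z. \<phi> w * \<psi> w) = (\<lambda>u\<in>X. pull \<phi> u * pull \<psi> u)" for \<phi> \<psi>
    unfolding pull_def by (rule restrict_ext) (use \<Gamma>(2) in auto)
  have pull_lincomb: "pull (\<lambda>w\<in>Z. a * \<phi> w + b * \<psi> w) = (\<lambda>u\<in>X. a * pull \<phi> u + b * pull \<psi> u)"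
    for a b \<phi> \<psi>
    unfolding pull_def by (rule restrict_ext) (use \<Gamma>(2) in auto)
  have dense: "\<phi> w = \<psi> w"
    if \<phi>: "\<phi> \<in> coord_ring Z" and \<psi>: "\<psi> \<in> coord_ring Z"
      and eq: "\<And>u. u \<in> X \<Longrightarrow> \<phi> (\<Gamma> u) = \<psi> (\<Gamma> u)" and w: "w \<in> Z" for \<phi> \<psi> w
  proof -
    obtain p q where p: "real_polynomial_function p" "\<phi> = (\<lambda>u\<in>Z. p u)"
      and q: "real_polynomial_function q" "\<psi> = (\<lambda>u\<in>Z. q u)"
      using \<phi> \<psi> by (metis coord_ringE)
    have "real_polynomial_function (\<lambda>v. p v - q v)"
      using p(1) q(1) by (rule real_polynomial_function_diff)
    moreover have "\<forall>v\<in>\<Gamma> ` X. p v - q v = 0"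
      using eq p(2) q(2) \<Gamma>(2) by (fastforce simp: image_subset_iff)
    ultimately have "p w - q w = 0"
      using \<Gamma>(3) w unfolding zariski_closure_def by fast
    then show ?thesis using p(2) q(2) w by simp
  qed
  have coord_image: "\<exists>r\<in>coord_ring Z. \<forall>u\<in>X. B (pull (\<lambda>w\<in>Z. w \<bullet> b)) (pull \<psi>) u = r (\<Gamma> u)"
    if "b \<in> Basis" "\<psi> \<in> coord_ring Z" for b \<psi>
    using that(2)
  proof (induction rule: coord_ring_induct)
    case (const a)
    show ?case
      by (intro bexI[of _ "\<lambda>w\<in>Z. 0"] ballI)
        (simp_all add: pull_const biderivation_const_right[OF D] pull_ring \<Gamma>_in
           coord_ring_const coord_ring_coord restrict_apply' del: restrict_apply)
  next
    case (coord c)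
    show ?case using gen[OF \<open>b \<in> Basis\<close> coord] by (simp only: pull_coord)
  next
    case (add \<phi> \<psi>)
    then obtain r s where "r \<in> coord_ring Z" "\<forall>u\<in>X. B (pull (\<lambda>w\<in>Z. w \<bullet> b)) (pull \<phi>) u = r (\<Gamma> u)"
        "s \<in> coord_ring Z" "\<forall>u\<in>X. B (pull (\<lambda>w\<in>Z. w \<bullet> b)) (pull \<psi>) u = s (\<Gamma> u)"
      by blast
    then show ?case
      using add.hyps
      by (intro bexI[of _ "\<lambda>w\<in>Z. r w + s w"] ballI coord_ring_add)
        (simp_all add: pull_add biderivation_add_right[OF D] pull_ring coord_ring_coord
          \<Gamma>_in restrict_apply' del: restrict_apply)
  next
    case (mult \<phi> \<psi>)
    then obtain r s where "r \<in> coord_ring Z" "\<forall>u\<in>X. B (pull (\<lambda>w\<in>Z. w \<bullet> b)) (pull \<phi>) u = r (\<Gamma> u)"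
        "s \<in> coord_ring Z" "\<forall>u\<in>X. B (pull (\<lambda>w\<in>Z. w \<bullet> b)) (pull \<psi>) u = s (\<Gamma> u)"
      by blast
    then show ?case
      using mult.hyps
      by (intro bexI[of _ "\<lambda>w\<in>Z. (\<lambda>w\<in>Z. \<phi> w * s w) w + (\<lambda>w\<in>Z. r w * \<psi> w) w"] ballI
            coord_ring_add coord_ring_mult)
        (simp_all add: pull_mult biderivation_mult_right[OF D] pull_ring coord_ring_coord pull_apply
          \<Gamma>_in restrict_apply' del: restrict_apply)
  qed
  have image: "\<exists>r\<in>coord_ring Z. \<forall>u\<in>X. B (pull \<phi>) (pull \<psi>) u = r (\<Gamma> u)"
    if "\<phi> \<in> coord_ring Z" "\<psi> \<in> coord_ring Z" for \<phi> \<psi>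
    using that(1)
  proof (induction rule: coord_ring_induct)
    case (const a)
    show ?case
      by (intro bexI[of _ "\<lambda>w\<in>Z. 0"] ballI)
        (simp_all add: that pull_const biderivation_const_left[OF D] pull_ring \<Gamma>_in
           coord_ring_const coord_ring_coord restrict_apply' del: restrict_apply)
  next
    case (coord c)
    show ?case by (rule coord_image[OF coord that(2)])
  next
    case (add \<phi>1 \<phi>2)
    then obtain r s where "r \<in> coord_ring Z" "\<forall>u\<in>X. B (pull \<phi>1) (pull \<psi>) u = r (\<Gamma> u)"
        "s \<in> coord_ring Z" "\<forall>u\<in>X. B (pull \<phi>2) (pull \<psi>) u = s (\<Gamma> u)"
      by blast
    then show ?case
      using add.hyps that
      by (intro bexI[of _ "\<lambda>w\<in>Z. r w + s w"] ballI coord_ring_add)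
        (simp_all add: pull_add biderivation_add_left[OF D] pull_ring coord_ring_coord
          \<Gamma>_in restrict_apply' del: restrict_apply)
  next
    case (mult \<phi>1 \<phi>2)
    then obtain r s where "r \<in> coord_ring Z" "\<forall>u\<in>X. B (pull \<phi>1) (pull \<psi>) u = r (\<Gamma> u)"
        "s \<in> coord_ring Z" "\<forall>u\<in>X. B (pull \<phi>2) (pull \<psi>) u = s (\<Gamma> u)"
      by blast
    then show ?case
      using mult.hyps that
      by (intro bexI[of _ "\<lambda>w\<in>Z. (\<lambda>w\<in>Z. \<phi>1 w * s w) w + (\<lambda>w\<in>Z. r w * \<phi>2 w) w"] ballI
            coord_ring_add coord_ring_mult)
        (simp_all add: pull_mult biderivation_mult_left[OF D] pull_ring coord_ring_coord pull_apply
          \<Gamma>_in restrict_apply' del: restrict_apply)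
  qed
  define B' where "B' \<phi> \<psi> = (SOME r. r \<in> coord_ring Z \<and> (\<forall>u\<in>X. B (pull \<phi>) (pull \<psi>) u = r (\<Gamma> u)))"
    for \<phi> \<psi>
  have B': "B' \<phi> \<psi> \<in> coord_ring Z" "\<And>u. u \<in> X \<Longrightarrow> B' \<phi> \<psi> (\<Gamma> u) = B (pull \<phi>) (pull \<psi>) u"
    if "\<phi> \<in> coord_ring Z" "\<psi> \<in> coord_ring Z" for \<phi> \<psi>
  proof -
    have "\<exists>r. r \<in> coord_ring Z \<and> (\<forall>u\<in>X. B (pull \<phi>) (pull \<psi>) u = r (\<Gamma> u))"
      using image[OF that] by blast
    from someI_ex[OF this, folded B'_def]
    show "B' \<phi> \<psi> \<in> coord_ring Z" "\<And>u. u \<in> X \<Longrightarrow> B' \<phi> \<psi> (\<Gamma> u) = B (pull \<phi>) (pull \<psi>) u"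
      by auto
  qed
  have pull_B': "pull (B' \<phi> \<psi>) = B (pull \<phi>) (pull \<psi>)"
    if "\<phi> \<in> coord_ring Z" "\<psi> \<in> coord_ring Z" for \<phi> \<psi>
    using that
    by (intro coord_ring_eqI[of _ X]) (auto simp: pull_ring B' biderivation_closed[OF D] pull_apply)
  have "poisson_bracket Z B'"
    unfolding poisson_bracket_def
  proof (intro conjI ballI allI)
    fix f g w assume f: "f \<in> coord_ring Z" and g: "g \<in> coord_ring Z"
    show "B' f g \<in> coord_ring Z" by (rule B'(1)[OF f g])
    assume w: "w \<in> Z"
    have "B' f g w = (\<lambda>w\<in>Z. (-1) * B' g f w + 0 * B' g f w) w"
    proof (rule dense[OF B'(1)[OF f g] coord_ring_lincomb[OF B'(1)[OF g f] B'(1)[OF g f]] _ w])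
      fix u assume u: "u \<in> X"
      show "B' f g (\<Gamma> u) = (\<lambda>w\<in>Z. (-1) * B' g f w + 0 * B' g f w) (\<Gamma> u)"
        using biderivation_skew[OF D pull_ring[OF f] pull_ring[OF g] u]
        by (simp add: \<Gamma>_in u B'(2)[OF f g u] B'(2)[OF g f u])
    qed
    then show "B' f g w = - B' g f w" using w by simp
    fix k assume k: "k \<in> coord_ring Z"
    show "B' (\<lambda>w\<in>Z. a * f w + b * g w) k w = a * B' f k w + b * B' g k w" for a b
    proof -
      have "B' (\<lambda>w\<in>Z. a * f w + b * g w) k w = (\<lambda>w\<in>Z. a * B' f k w + b * B' g k w) w"
        by (rule dense[OF _ _ _ w])
          (use f g k in \<open>simp_all add: B' coord_ring_lincomb pull_ring pull_lincomb
             biderivation_lincomb_left[OF D]  \<Gamma>_in restrict_apply' del: restrict_apply\<close>)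
      then show ?thesis using w by simp
    qed
    have "B' (\<lambda>w\<in>Z. f w * g w) k w
        = (\<lambda>w\<in>Z. (\<lambda>w\<in>Z. f w * B' g k w) w + (\<lambda>w\<in>Z. B' f k w * g w) w) w"
      by (rule dense[OF _ _ _ w])
          (use f g k in \<open>simp_all add: B' coord_ring_mult coord_ring_add pull_ring pull_mult
             pull_apply biderivation_mult_left[OF D]  \<Gamma>_in restrict_apply' del: restrict_apply\<close>)
    then show "B' (\<lambda>w\<in>Z. f w * g w) k w = f w * B' g k w + B' f k w * g w" using w by simp
    have jac: "B (pull f) (B (pull g) (pull k)) u + B (pull g) (B (pull k) (pull f)) u
        + B (pull k) (B (pull f) (pull g)) u = 0" if "u \<in> X" for u
      using B that pull_ring[OF f] pull_ring[OF g] pull_ring[OF k]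
      unfolding poisson_bracket_iff by blast
    have "(\<lambda>w\<in>Z. (\<lambda>w\<in>Z. B' f (B' g k) w + B' g (B' k f) w) w + B' k (B' f g) w) w = (\<lambda>w\<in>Z. 0) w"
      by (rule dense[OF _ _ _ w])
          (use f g k jac in \<open>simp_all add: B' pull_B' coord_ring_const coord_ring_add pull_ring
              \<Gamma>_in restrict_apply' del: restrict_apply\<close>)
    then show "B' f (B' g k) w + B' g (B' k f) w + B' k (B' f g) w = 0"
      using w by simp
  qed
  then have "induces_bracket \<Gamma> X B Z B'"
    unfolding induces_bracket_def using B'(2) by (simp add: pull_def)
  then show ?thesis by (intro exI)
qed

text \<open>Two brackets with the same values on pairs of coordinates agree, since both are given by the
  chain rule.\<close>

lemma biderivation_eqI:
  fixes B B' :: "'a::euclidean_space bracket"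
  assumes B: "skew_biderivation Z B" and B': "skew_biderivation Z B'"
    and gen: "\<And>b c z. b \<in> Basis \<Longrightarrow> c \<in> Basis \<Longrightarrow> z \<in> Z \<Longrightarrow>
      B (\<lambda>u\<in>Z. u \<bullet> b) (\<lambda>u\<in>Z. u \<bullet> c) z = B' (\<lambda>u\<in>Z. u \<bullet> b) (\<lambda>u\<in>Z. u \<bullet> c) z"
    and f: "f \<in> coord_ring Z" and g: "g \<in> coord_ring Z"
  shows "B f g = B' f g"
proof -
  have 1: "B (\<lambda>u\<in>Z. u \<bullet> b) g z = B' (\<lambda>u\<in>Z. u \<bullet> b) g z"
    if "b \<in> Basis" "z \<in> Z" "g \<in> coord_ring Z" for b g z
  proof -
    obtain q where q: "real_polynomial_function q" "g = (\<lambda>u\<in>Z. q u)"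
      using \<open>g \<in> _\<close> by (rule coord_ringE)
    show ?thesis
      unfolding q(2) biderivation_eq_bracket_ext[OF B coord_ring_coord q(1) that(2)]
        biderivation_eq_bracket_ext[OF B' coord_ring_coord q(1) that(2)] bracket_ext_def
      by (intro sum.cong refl) (simp only: gen that)
  qed
  have "B g f z = B' g f z" if z: "z \<in> Z" for z
  proof -
    obtain q where q: "real_polynomial_function q" "f = (\<lambda>u\<in>Z. q u)"
      using f by (rule coord_ringE)
    have "B g (\<lambda>u\<in>Z. u \<bullet> b) z = B' g (\<lambda>u\<in>Z. u \<bullet> b) z" if "b \<in> Basis" for b
      using biderivation_skew[OF B g coord_ring_coord z] biderivation_skew[OF B' g coord_ring_coord z]
        1[OF that z g] by metis
    then show ?thesis
      unfolding q(2) biderivation_eq_bracket_ext[OF B g q(1) z]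
        biderivation_eq_bracket_ext[OF B' g q(1) z] bracket_ext_def
      by (intro sum.cong refl) (simp only:)
  qed
  then show ?thesis
    using biderivation_skew[OF B f g] biderivation_skew[OF B' f g]
    by (intro coord_ring_eqI[of _ Z] biderivation_closed[OF B f g] biderivation_closed[OF B' f g]) simp
qed

section \<open>The Dirac-Poisson bracket\<close>

definition lorentz_dual :: "real^3 \<Rightarrow> real^3" where
  "lorentz_dual v = vector [v$1, v$2, - (v$3)]"

lemma lorentz_dual_nth [simp]:
  "lorentz_dual v $ 1 = v$1" "lorentz_dual v $ 2 = v$2" "lorentz_dual v $ 3 = - (v$3)"
  by (simp_all add: lorentz_dual_def)

lemma inner_real3: "(u::real^3) \<bullet> v = u$1 * v$1 + u$2 * v$2 + u$3 * v$3"
  by (simp add: inner_vec_def sum_3)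

lemma lorentz_dual_inner: "lorentz_dual u \<bullet> v = lorentz u v"
  by (simp add: inner_real3 lorentz_def)

lemma lorentz_commute: "lorentz u v = lorentz v u"
  by (simp add: lorentz_def)

text \<open>The Hamiltonian vector field, for the Dirac-Poisson bracket, of the linear form
  \<open>u \<mapsto> u \<bullet> b\<close>: its components are the brackets of this form with the coordinates.  As it is linear
  in \<open>b\<close>, inserting a gradient for \<open>b\<close> gives the Hamiltonian vector field of a nonlinear function.\<close>

definition dirac_field :: "phase \<Rightarrow> phase \<Rightarrow> phase" where
  "dirac_field b z =
     (- lorentz_dual (snd b) - (fst z \<bullet> snd b) *\<^sub>R fst z,
      lorentz_dual (fst b) + (fst z \<bullet> fst b) *\<^sub>R fst z
        + (fst z \<bullet> snd b) *\<^sub>R snd z - (snd z \<bullet> snd b) *\<^sub>R fst z)"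

lemma dirac_field_inner:
  "dirac_field b z \<bullet> c = - lorentz (snd b) (fst c) - (fst z \<bullet> snd b) * (fst z \<bullet> fst c)
     + lorentz (fst b) (snd c) + (fst z \<bullet> fst b) * (fst z \<bullet> snd c)
     + (fst z \<bullet> snd b) * (snd z \<bullet> snd c) - (snd z \<bullet> snd b) * (fst z \<bullet> snd c)"
  by (simp add: dirac_field_def inner_prod_def inner_diff_left inner_add_left lorentz_dual_inner)

lemma dirac_field_skew: "dirac_field b z \<bullet> c = - (dirac_field c z \<bullet> b)"
  by (simp add: dirac_field_inner lorentz_commute[of "snd c"] lorentz_commute[of "fst c"] algebra_simps)

lemma real_polynomial_function_fst_inner: "real_polynomial_function (\<lambda>z. fst z \<bullet> b)"
  by (intro real_polynomial_function_linear
      bounded_linear_compose[OF bounded_linear_inner_left bounded_linear_fst])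

lemma real_polynomial_function_snd_inner: "real_polynomial_function (\<lambda>z. snd z \<bullet> b)"
  by (intro real_polynomial_function_linear
      bounded_linear_compose[OF bounded_linear_inner_left bounded_linear_snd])

lemma dirac_field_polynomial: "real_polynomial_function (\<lambda>z. dirac_field b z \<bullet> c)"
  unfolding dirac_field_inner
  by (intro polynomial_intros real_polynomial_function_fst_inner real_polynomial_function_snd_inner)

text \<open>The fields define a Poisson structure on all of \<open>\<real>\<^sup>6\<close>: the
  terms of the Jacobi sum cancel identically by the symmetry of the Lorentz product.\<close>

lemma dirac_field_jacobi:
  "partial_deriv (\<lambda>u. dirac_field c u \<bullet> d) (dirac_field b z) z
   + partial_deriv (\<lambda>u. dirac_field d u \<bullet> b) (dirac_field c z) z
   + partial_deriv (\<lambda>u. dirac_field b u \<bullet> c) (dirac_field d z) z = 0"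
proof -
  have pd: "partial_deriv (\<lambda>u. dirac_field c u \<bullet> d) v z =
      - ((fst v \<bullet> snd c) * (fst z \<bullet> fst d) + (fst z \<bullet> snd c) * (fst v \<bullet> fst d))
      + ((fst v \<bullet> fst c) * (fst z \<bullet> snd d) + (fst z \<bullet> fst c) * (fst v \<bullet> snd d))
      + ((fst v \<bullet> snd c) * (snd z \<bullet> snd d) + (fst z \<bullet> snd c) * (snd v \<bullet> snd d))
      - ((snd v \<bullet> snd c) * (fst z \<bullet> snd d) + (snd z \<bullet> snd c) * (fst v \<bullet> snd d))" for c d v
    unfolding dirac_field_inner
    by (rule partial_deriv_eq_frechet) (auto intro!: derivative_eq_intros simp: algebra_simps)
  have fst_field: "fst (dirac_field b z) \<bullet> e = - lorentz (snd b) e - (fst z \<bullet> snd b) * (fst z \<bullet> e)"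
    for b e
    by (simp add: dirac_field_def inner_diff_left lorentz_dual_inner)
  have snd_field: "snd (dirac_field b z) \<bullet> e = lorentz (fst b) e + (fst z \<bullet> fst b) * (fst z \<bullet> e)
      + (fst z \<bullet> snd b) * (snd z \<bullet> e) - (snd z \<bullet> snd b) * (fst z \<bullet> e)" for b e
    by (simp add: dirac_field_def inner_diff_left inner_add_left lorentz_dual_inner)
  have comm: "lorentz (snd c) (snd b) = lorentz (snd b) (snd c)"
    "lorentz (snd d) (snd b) = lorentz (snd b) (snd d)"
    "lorentz (snd d) (snd c) = lorentz (snd c) (snd d)"
    "lorentz (fst e) (snd e') = lorentz (snd e') (fst e)" for e e'
    by (rule lorentz_commute)+
  show ?thesis
    unfolding pd fst_field snd_field comm by (simp add: algebra_simps)
qed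

text \<open>\<open>V\<close> is a manifold: a line \<open>z + t v\<close> with \<open>v\<close> tangent at \<open>z\<close> leaves \<open>V\<close> only to second
  order, and normalising \<open>x\<close> and projecting \<open>y\<close> moves it back into \<open>V\<close>.  So a polynomial
  that vanishes on \<open>V\<close> has derivative zero along \<open>v\<close>.\<close>

lemma partial_deriv_tangent_V:
  assumes p: "real_polynomial_function p" and vanish: "\<And>u. u \<in> V \<Longrightarrow> p u = 0"
    and z: "(x, y) \<in> V" and tangent: "lorentz x a = 0" "lorentz a y + lorentz x b = 0"
  shows "partial_deriv p (a, b) (x, y) = 0"
proof -
  define \<alpha> where "\<alpha> = lorentz a a"
  define \<beta> where "\<beta> = lorentz a b"
  define l where "l t = 1 / sqrt (1 - t^2 * \<alpha>)" for t
  define m where "m t = t^2 * \<beta> / (1 - t^2 * \<alpha>)" for t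
  define c where "c t = (l t *\<^sub>R (x + t *\<^sub>R a), y + t *\<^sub>R b + m t *\<^sub>R (x + t *\<^sub>R a))" for t
  have xx: "lorentz x x = -1" "lorentz x y = 0"
    using z by (auto simp: V_def)
  \<comment> \<open>The factor \<open>l\<close> restores \<open>\<langle>x, x\<rangle>\<^sub>L = -1\<close> and \<open>m\<close> restores \<open>\<langle>x, y\<rangle>\<^sub>L = 0\<close>; both
    differ from their values at zero by terms of second order.\<close>
  have c_V: "c t \<in> V" if pos: "1 - t^2 * \<alpha> > 0" for t
  proof -
    let ?x = "x + t *\<^sub>R a" and ?y = "y + t *\<^sub>R b"
    have "lorentz ?x ?x = lorentz x x + 2 * t * lorentz x a + t^2 * \<alpha>"
      by (simp add: lorentz_def \<alpha>_def algebra_simps power2_eq_square)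
    then have 1: "lorentz ?x ?x = - (1 - t^2 * \<alpha>)" using xx tangent by simp
    have "lorentz ?x ?y = lorentz x y + t * (lorentz a y + lorentz x b) + t^2 * \<beta>"
      by (simp add: lorentz_def \<beta>_def algebra_simps power2_eq_square)
    then have 2: "lorentz ?x ?y = t^2 * \<beta>" using xx tangent by simp
    have l: "(l t)^2 = 1 / (1 - t^2 * \<alpha>)" using pos by (simp add: l_def power_divide)
    have "lorentz (l t *\<^sub>R ?x) (l t *\<^sub>R ?x) = (l t)^2 * lorentz ?x ?x"
      by (simp add: lorentz_def algebra_simps power2_eq_square)
    also have "\<dots> = -1" using pos by (simp add: 1 l divide_simps)
    finally have "lorentz (l t *\<^sub>R ?x) (l t *\<^sub>R ?x) = -1" .
    moreover have "lorentz (l t *\<^sub>R ?x) (?y + m t *\<^sub>R ?x)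
        = l t * (lorentz ?x ?y + m t * lorentz ?x ?x)"
      by (simp add: lorentz_def algebra_simps)
    moreover have "lorentz ?x ?y + m t * lorentz ?x ?x = 0"
      using pos by (simp add: 1 2 m_def divide_simps) (simp add: algebra_simps)
    ultimately show ?thesis by (simp add: V_def c_def)
  qed
  have "((\<lambda>t. 1 - t^2 * \<alpha>) \<longlongrightarrow> 1 - 0^2 * \<alpha>) (at 0)"
    by (intro tendsto_intros)
  then have "eventually (\<lambda>t. 1 - t^2 * \<alpha> > 0) (at 0)"
    by (intro order_tendstoD) auto
  then have zero: "eventually (\<lambda>t. p (c t) = 0) (at 0)"
    by eventually_elim (simp add: vanish c_V)
  have l0: "(l has_real_derivative 0) (at 0)" and m0: "(m has_real_derivative 0) (at 0)"
    unfolding l_def m_def by (auto intro!: derivative_eq_intros)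
  have [simp]: "l 0 = 1" "m 0 = 0" by (simp_all add: l_def m_def)
  then have c0: "c 0 = (x, y)" by (simp add: c_def)
  have c_deriv: "(c has_vector_derivative (a, b)) (at 0)"
    unfolding c_def
    by (rule has_vector_derivative_Pair)
      (auto intro!: derivative_eq_intros l0 m0
        simp: has_real_derivative_iff_has_vector_derivative[symmetric])
  obtain p' where p': "(p has_derivative p') (at (x, y))"
    using differentiable_at_real_polynomial_function[OF p, of "(x, y)" UNIV]
    unfolding differentiable_def by blast
  have "((p \<circ> c) has_vector_derivative p' (a, b)) (at 0)"
    using vector_derivative_diff_chain_within[of c "(a, b)" 0 UNIV p p'] c_deriv p'
    by (simp add: c0 has_derivative_at_withinI)
  moreover have "((p \<circ> c) has_vector_derivative 0) (at 0)"
    unfolding has_vector_derivative_def scaleR_zero_right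
    by (rule has_derivative_transform_eventually[OF has_derivative_const])
       (use zero c0 vanish[OF z] in \<open>auto simp: o_def elim: eventually_mono\<close>)
  ultimately have "p' (a, b) = 0"
    using vector_derivative_unique_at by blast
  then show ?thesis by (simp add: partial_deriv_eq_frechet[OF p'])
qed

text \<open>For the field of \<open>b = (b\<^sub>1, b\<^sub>2)\<close> the expressions in the two conditions of tangency are
  \<open>\<langle>x, x\<rangle>\<^sub>L + 1\<close> times \<open>- x \<bullet> b\<^sub>2\<close> and \<open>x \<bullet> b\<^sub>1 - y \<bullet> b\<^sub>2\<close>, so they vanish on \<open>V\<close>.\<close>

lemma dirac_field_tangent:
  assumes "real_polynomial_function p" "\<And>u. u \<in> V \<Longrightarrow> p u = 0" "z \<in> V"
  shows "partial_deriv p (dirac_field b z) z = 0"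
proof -
  obtain x y b1 b2 where [simp]: "z = (x, y)" "b = (b1, b2)" by (metis surj_pair)
  have V: "lorentz x x = -1" "lorentz x y = 0"
    using assms(3) by (auto simp: V_def)
  have lin: "lorentz u (v + w) = lorentz u v + lorentz u w"
    "lorentz u (v - w) = lorentz u v - lorentz u w" "lorentz u (- v) = - lorentz u v"
    "lorentz u (r *\<^sub>R v) = r * lorentz u v" "lorentz u (lorentz_dual v) = u \<bullet> v" for u v w r
    by (simp_all add: lorentz_def inner_real3 algebra_simps)
  show ?thesis
    unfolding dirac_field_def \<open>z = _\<close>
    by (rule partial_deriv_tangent_V)
      (use assms V lorentz_commute[of y x] in
        \<open>simp_all add: lin lorentz_commute[of "_ + _"] lorentz_commute[of "_ - _"]
          lorentz_commute[of "- _"] inner_commute\<close>)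
qed

lemma Basis_phase_cases:
  assumes "b \<in> (Basis :: phase set)"
  obtains i where "b = (axis i 1, 0)" | i where "b = (0, axis i 1)"
  using assms by (auto simp: Basis_prod_def Basis_vec_def)

lemma xcoord_eq: "xcoord i = (\<lambda>u\<in>V. u \<bullet> (axis i 1, 0))"
  unfolding xcoord_def by (rule restrict_ext) (auto simp: inner_axis)

lemma ycoord_eq: "ycoord i = (\<lambda>u\<in>V. u \<bullet> (0, axis i 1))"
  unfolding ycoord_def by (rule restrict_ext) (auto simp: inner_axis)

lemma lorentz_axis: "lorentz (axis i 1) (axis j 1) = lorentz_metric i j"
  using exhaust_3[of i] exhaust_3[of j] by (auto simp: lorentz_def lorentz_metric_def axis_def)

lemma lorentz_zero [simp]: "lorentz 0 v = 0" "lorentz v 0 = 0"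
  by (simp_all add: lorentz_def)

lemma axis_Basis_phase [simp]: "(axis i 1, 0) \<in> (Basis :: phase set)" "(0, axis i 1) \<in> (Basis :: phase set)"
  by (auto simp: Basis_prod_def)

lemma dirac_poisson_bracket_iff:
  "dirac_poisson_bracket B \<longleftrightarrow> poisson_bracket V B \<and>
     (\<forall>b\<in>Basis. \<forall>c\<in>Basis. \<forall>z\<in>V.
        B (\<lambda>u\<in>V. u \<bullet> b) (\<lambda>u\<in>V. u \<bullet> c) z = dirac_field b z \<bullet> c)"
  (is "_ \<longleftrightarrow> _ \<and> ?values")
proof (cases "poisson_bracket V B")
  case False
  then show ?thesis unfolding dirac_poisson_bracket_def by blast
next
  case True
  then have D: "skew_biderivation V B" unfolding poisson_bracket_iff by (rule conjunct1)
  show ?thesis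
  proof
    assume L: "dirac_poisson_bracket B"
    have xx: "B (xcoord i) (xcoord j) (x, y) = 0"
      and xy: "B (xcoord i) (ycoord j) (x, y) = lorentz_metric i j + x$i * x$j"
      and yy: "B (ycoord i) (ycoord j) (x, y) = x$i * y$j - x$j * y$i"
      if "(x, y) \<in> V" for x y i j
      using L that unfolding dirac_poisson_bracket_def by blast+
    have yx: "B (ycoord i) (xcoord j) (x, y) = - (lorentz_metric i j + x$i * x$j)"
      if "(x, y) \<in> V" for x y i j
      using biderivation_skew[OF D _ _ that, of "ycoord i" "xcoord j"] xy[OF that, of j i]
      unfolding xcoord_eq ycoord_eq
      by (simp add: coord_ring_coord lorentz_metric_def del: restrict_apply)
    have "B (\<lambda>u\<in>V. u \<bullet> b) (\<lambda>u\<in>V. u \<bullet> c) z = dirac_field b z \<bullet> c"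
      if b: "b \<in> Basis" and c: "c \<in> Basis" and z: "z \<in> V" for b c z
    proof -
      obtain x y where [simp]: "z = (x, y)" by (metis surj_pair)
      show ?thesis
        using b
      proof (cases rule: Basis_phase_cases)
        case (1 i)
        show ?thesis using c
          by (cases rule: Basis_phase_cases)
             (use xx xy z in \<open>simp_all add: 1 xcoord_eq[symmetric] ycoord_eq[symmetric]
                dirac_field_inner lorentz_axis inner_axis del: restrict_apply\<close>)
      next
        case (2 i)
        show ?thesis using c
          by (cases rule: Basis_phase_cases)
             (use yx yy z in \<open>simp_all add: 2 xcoord_eq[symmetric] ycoord_eq[symmetric]
                dirac_field_inner lorentz_axis inner_axis del: restrict_apply\<close>)
      qed
    qed
    then show "poisson_bracket V B \<and> ?values" using True by blast
  next
    assume "poisson_bracket V B \<and> ?values"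
    then show "dirac_poisson_bracket B"
      unfolding dirac_poisson_bracket_def xcoord_eq ycoord_eq
      by (auto simp: dirac_field_inner lorentz_axis inner_axis simp del: restrict_apply)
  qed
qed

lemma dirac_poisson_bracket_exists: "\<exists>B. dirac_poisson_bracket B"
  unfolding dirac_poisson_bracket_iff
  by (rule poisson_bracket_from_hamiltonian_fields)
     (rule dirac_field_polynomial dirac_field_skew dirac_field_tangent dirac_field_jacobi; assumption?)+

text \<open>Bracketing a coordinate with any differentiable function is differentiation along the field of
  this coordinate, also when the function is not a polynomial.\<close>

lemma dirac_bracket_ext:
  assumes B: "dirac_poisson_bracket B" and z: "z \<in> V" and b: "b \<in> Basis"
    and h: "h differentiable at z"
  shows "bracket_ext V B (\<lambda>u\<in>V. u \<bullet> b) h z = partial_deriv h (dirac_field b z) z"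
proof -
  have "bracket_ext V B (\<lambda>u\<in>V. u \<bullet> b) h z
      = (\<Sum>c\<in>Basis. (dirac_field b z \<bullet> c) * partial_deriv h c z)"
    unfolding bracket_ext_def using B z b
    by (intro sum.cong) (auto simp: dirac_poisson_bracket_iff simp del: restrict_apply)
  then show ?thesis by (simp only: partial_deriv_sum_Basis[OF h])
qed

text \<open>The chain rule in both arguments: a bracket of polynomials at a point depends only on their
  gradients there.\<close>

lemma dirac_bracket_gradients:
  assumes B: "dirac_poisson_bracket B" and z: "z \<in> V"
    and p: "real_polynomial_function p" "(p has_derivative (\<lambda>v. G \<bullet> v)) (at z)"
    and q: "real_polynomial_function q" "(q has_derivative (\<lambda>v. K \<bullet> v)) (at z)"
  shows "B (\<lambda>u\<in>V. p u) (\<lambda>u\<in>V. q u) z = dirac_field G z \<bullet> K"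
proof -
  have D: "skew_biderivation V B"
    using B unfolding dirac_poisson_bracket_def poisson_bracket_iff by blast
  have coord: "B (\<lambda>u\<in>V. p u) (\<lambda>u\<in>V. u \<bullet> b) z = dirac_field G z \<bullet> b" if b: "b \<in> Basis" for b
  proof -
    have "B (\<lambda>u\<in>V. p u) (\<lambda>u\<in>V. u \<bullet> b) z = - B (\<lambda>u\<in>V. u \<bullet> b) (\<lambda>u\<in>V. p u) z"
      by (rule biderivation_skew[OF D coord_ringI[OF p(1)] coord_ring_coord z])
    also have "\<dots> = - bracket_ext V B (\<lambda>u\<in>V. u \<bullet> b) p z"
      by (simp only: biderivation_eq_bracket_ext[OF D coord_ring_coord p(1) z])
    also have "\<dots> = - (G \<bullet> dirac_field b z)"
      by (simp only: dirac_bracket_ext[OF B z b differentiable_at_real_polynomial_function[OF p(1)]]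
          partial_deriv_eq_frechet[OF p(2)])
    also have "\<dots> = dirac_field G z \<bullet> b"
      by (subst dirac_field_skew) (simp add: inner_commute)
    finally show ?thesis .
  qed
  have "B (\<lambda>u\<in>V. p u) (\<lambda>u\<in>V. q u) z = bracket_ext V B (\<lambda>u\<in>V. p u) q z"
    by (rule biderivation_eq_bracket_ext[OF D coord_ringI[OF p(1)] q(1) z])
  also have "\<dots> = (\<Sum>b\<in>Basis. (dirac_field G z \<bullet> b) * partial_deriv q b z)"
    unfolding bracket_ext_def by (intro sum.cong refl) (simp only: coord)
  also have "\<dots> = partial_deriv q (dirac_field G z) z"
    by (rule partial_deriv_sum_Basis[OF differentiable_at_real_polynomial_function[OF q(1)]])
  also have "\<dots> = dirac_field G z \<bullet> K"
    by (simp add: partial_deriv_eq_frechet[OF q(2)] inner_commute)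
  finally show ?thesis .
qed

section \<open>Orbits are parabolas\<close>

text \<open>In coordinates \<open>(u, v)\<close> along the tangent \<open>a\<close> at the vertex \<open>p\<close> and the axis \<open>b\<close> the curve is
  \<open>v = u\<^sup>2\<close>.  The focus is \<open>p + f b\<close> and the directrix is parallel to \<open>a\<close> through \<open>p - f b\<close>.
  Equal squared distances mean \<open>u\<^sup>2 |a|\<^sup>2 + (v - f)\<^sup>2 |b|\<^sup>2 = (v + f)\<^sup>2 |b|\<^sup>2\<close>, that is
  \<open>u\<^sup>2 |a|\<^sup>2 = 4 f v |b|\<^sup>2\<close>, which fixes \<open>f\<close>.\<close>

lemma parabola_in_plane_orthogonal:
  fixes p a b :: "'a::euclidean_space"
  assumes orth: "a \<bullet> b = 0" and nz: "a \<noteq> 0" "b \<noteq> 0"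
  shows "parabola_in_plane {p + u *\<^sub>R a + v *\<^sub>R b | u v. True} {p + s *\<^sub>R a + s^2 *\<^sub>R b | s. True}"
proof -
  define f where "f = (a \<bullet> a) / (4 * (b \<bullet> b))"
  define P where "P = {p + u *\<^sub>R a + v *\<^sub>R b | u v. True}"
  define L where "L = {p + u *\<^sub>R a - f *\<^sub>R b | u. True}"
  have aa: "a \<bullet> a > 0" and bb: "b \<bullet> b > 0" using nz by simp_all
  then have f: "f > 0" by (simp add: f_def)
  have L_eq: "L = (+) (p - f *\<^sub>R b) ` span {a}"
    by (auto simp: L_def span_singleton algebra_simps image_iff)
  have dist_sq: "(dist (p + u *\<^sub>R a + v *\<^sub>R b) (p + u' *\<^sub>R a + v' *\<^sub>R b))^2
      = (u - u')^2 * (a \<bullet> a) + (v - v')^2 * (b \<bullet> b)" for u v u' v'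
  proof -
    have "p + u *\<^sub>R a + v *\<^sub>R b - (p + u' *\<^sub>R a + v' *\<^sub>R b) = (u - u') *\<^sub>R a + (v - v') *\<^sub>R b"
      by (simp add: algebra_simps)
    then have "(dist (p + u *\<^sub>R a + v *\<^sub>R b) (p + u' *\<^sub>R a + v' *\<^sub>R b))^2
        = ((u - u') *\<^sub>R a + (v - v') *\<^sub>R b) \<bullet> ((u - u') *\<^sub>R a + (v - v') *\<^sub>R b)"
      by (simp only: dist_norm power2_norm_eq_inner)
    then show ?thesis
      using orth by (simp add: inner_add_left inner_add_right inner_commute[of b a] power2_eq_square)
  qed
  have dist_L: "(dist (p + u *\<^sub>R a + v *\<^sub>R b) (p + u' *\<^sub>R a - f *\<^sub>R b))^2
      = (u - u')^2 * (a \<bullet> a) + (v + f)^2 * (b \<bullet> b)" for u v u'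
    using dist_sq[of u v u' "-f"] by simp
  have infdist: "infdist (p + u *\<^sub>R a + v *\<^sub>R b) L = sqrt ((v + f)^2 * (b \<bullet> b))" for u v
  proof (rule antisym)
    have "infdist (p + u *\<^sub>R a + v *\<^sub>R b) L \<le> dist (p + u *\<^sub>R a + v *\<^sub>R b) (p + u *\<^sub>R a - f *\<^sub>R b)"
      by (rule infdist_le) (auto simp: L_def)
    also have "\<dots> = sqrt ((v + f)^2 * (b \<bullet> b))"
      using dist_L[of u v u] by (metis abs_of_nonneg add_0 cancel_comm_monoid_add_class.diff_cancel
          mult_zero_left power_zero_numeral real_sqrt_abs zero_le_dist)
    finally show "infdist (p + u *\<^sub>R a + v *\<^sub>R b) L \<le> sqrt ((v + f)^2 * (b \<bullet> b))" .
    have "sqrt ((v + f)^2 * (b \<bullet> b)) \<le> dist (p + u *\<^sub>R a + v *\<^sub>R b) l" if L: "l \<in> L" for l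
    proof -
      obtain u' where l: "l = p + u' *\<^sub>R a - f *\<^sub>R b" using L by (auto simp: L_def)
      have "(v + f)^2 * (b \<bullet> b) \<le> (dist (p + u *\<^sub>R a + v *\<^sub>R b) l)^2"
        unfolding l dist_L using aa by simp
      then show ?thesis by (rule real_le_lsqrt[rotated 1]) simp_all
    qed
    then show "sqrt ((v + f)^2 * (b \<bullet> b)) \<le> infdist (p + u *\<^sub>R a + v *\<^sub>R b) L"
      unfolding infdist_def by (auto simp: L_def intro!: cINF_greatest)
  qed
  have equidistant: "dist (p + u *\<^sub>R a + v *\<^sub>R b) (p + f *\<^sub>R b)
      = infdist (p + u *\<^sub>R a + v *\<^sub>R b) L \<longleftrightarrow> v = u^2" for u v
  proof -
    have "dist (p + u *\<^sub>R a + v *\<^sub>R b) (p + f *\<^sub>R b) = infdist (p + u *\<^sub>R a + v *\<^sub>R b) L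
        \<longleftrightarrow> (dist (p + u *\<^sub>R a + v *\<^sub>R b) (p + f *\<^sub>R b))^2 = (v + f)^2 * (b \<bullet> b)"
      unfolding infdist using bb
      by (metis mult_nonneg_nonneg order_less_imp_le real_sqrt_pow2 real_sqrt_power
          real_sqrt_unique zero_le_dist zero_le_power2)
    also have "(dist (p + u *\<^sub>R a + v *\<^sub>R b) (p + f *\<^sub>R b))^2
        = u^2 * (a \<bullet> a) + (v - f)^2 * (b \<bullet> b)"
      using dist_sq[of u v 0 f] by simp
    also have "u^2 * (a \<bullet> a) + (v - f)^2 * (b \<bullet> b) = (v + f)^2 * (b \<bullet> b)
        \<longleftrightarrow> u^2 * (a \<bullet> a) = v * (4 * f * (b \<bullet> b))"
      by (auto simp: power2_eq_square algebra_simps)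
    also have "4 * f * (b \<bullet> b) = a \<bullet> a" using bb by (simp add: f_def)
    also have "u^2 * (a \<bullet> a) = v * (a \<bullet> a) \<longleftrightarrow> v = u^2" using aa by auto
    finally show ?thesis .
  qed
  have "affine L" "aff_dim L = 1"
    unfolding L_eq using nz
    by (simp_all add: affine_translation[symmetric] subspace_imp_affine aff_dim_translation_eq
        aff_dim_subspace)
  moreover have "p + f *\<^sub>R b \<in> P"
    unfolding P_def by (rule CollectI, rule exI[of _ 0], rule exI[of _ f]) simp
  moreover have "L \<subseteq> P"
  proof
    fix l assume "l \<in> L"
    then obtain u where "l = p + u *\<^sub>R a - f *\<^sub>R b" by (auto simp: L_def)
    then have "l = p + u *\<^sub>R a + (-f) *\<^sub>R b" by simp
    then show "l \<in> P" unfolding P_def by blast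
  qed
  moreover have "p + f *\<^sub>R b \<notin> L"
  proof
    assume "p + f *\<^sub>R b \<in> L"
    then obtain u where "p + f *\<^sub>R b = p + u *\<^sub>R a - f *\<^sub>R b" by (auto simp: L_def)
    then have "(dist (p + 0 *\<^sub>R a + f *\<^sub>R b) (p + u *\<^sub>R a - f *\<^sub>R b))^2 = 0" by simp
    then have "u^2 * (a \<bullet> a) + (2 * f)^2 * (b \<bullet> b) = 0" unfolding dist_L by simp
    moreover have "u^2 * (a \<bullet> a) \<ge> 0" "(2 * f)^2 * (b \<bullet> b) > 0" using f aa bb by simp_all
    ultimately show False by linarith
  qed
  moreover have "{p + s *\<^sub>R a + s^2 *\<^sub>R b | s. True} = {q \<in> P. dist q (p + f *\<^sub>R b) = infdist q L}"
    using equidistant by (auto simp: P_def)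
  ultimately show ?thesis
    unfolding parabola_in_plane_def P_def[symmetric] by blast
qed

text \<open>Shifting the parameter by \<open>k / 2\<close> changes the velocity at parameter zero by a multiple of \<open>b\<close>;
  with the \<open>k\<close> of orthogonal projection it becomes orthogonal to \<open>b\<close>, so parameter zero is the
  vertex.\<close>

lemma parabola_in_plane_quadratic_curve:
  fixes p a b :: "'a::euclidean_space"
  assumes indep: "a \<noteq> 0" "b \<noteq> 0" "\<And>r. a \<noteq> r *\<^sub>R b"
  shows "\<exists>P. affine P \<and> aff_dim P = 2 \<and> parabola_in_plane P {p + s *\<^sub>R a + s^2 *\<^sub>R b | s. True}"
proof -
  define k where "k = (a \<bullet> b) / (b \<bullet> b)"
  define a' where "a' = a - k *\<^sub>R b"
  define p' where "p' = p - (k / 2) *\<^sub>R a + (k / 2)^2 *\<^sub>R b"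
  have orth: "a' \<bullet> b = 0" using indep by (simp add: a'_def k_def inner_diff_left)
  have a': "a' \<noteq> 0" using indep(3)[of k] by (simp add: a'_def)
  let ?P = "{p' + u *\<^sub>R a' + v *\<^sub>R b | u v. True}"
  have shift: "p + s *\<^sub>R a + s^2 *\<^sub>R b = p' + (s + k / 2) *\<^sub>R a' + (s + k / 2)^2 *\<^sub>R b" for s
    by (rule euclidean_eqI)
      (simp add: a'_def p'_def inner_add_left inner_diff_left field_simps power2_eq_square)
  have curve: "{p + s *\<^sub>R a + s^2 *\<^sub>R b | s. True} = {p' + s *\<^sub>R a' + s^2 *\<^sub>R b | s. True}"
  proof (intro equalityI subsetI; clarsimp)
    show "\<exists>s'. p + s *\<^sub>R a + s^2 *\<^sub>R b = p' + s' *\<^sub>R a' + s'^2 *\<^sub>R b" for s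
      using shift by blast
    show "\<exists>s'. p' + s *\<^sub>R a' + s^2 *\<^sub>R b = p + s' *\<^sub>R a + s'^2 *\<^sub>R b" for s
      using shift[of "s - k / 2"] by (intro exI[of _ "s - k / 2"]) simp
  qed
  have span: "?P = (+) p' ` span {a', b}"
    by (auto simp: span_breakdown_eq span_singleton image_iff algebra_simps)
      (metis add.commute diff_add_cancel)+
  have "b \<notin> span {a'}"
  proof
    assume "b \<in> span {a'}"
    then obtain r where "b = r *\<^sub>R a'" by (auto simp: span_singleton)
    then have "b \<bullet> b = 0" using orth by (simp add: inner_commute)
    then show False using indep by simp
  qed
  then have "independent {b, a'}" "b \<noteq> a'"
    using a' by (auto simp: independent_insert span_base)
  then have "dim (span {a', b}) = 2"
    by (simp add: dim_eq_card_independent insert_commute)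
  then have "affine ?P" "aff_dim ?P = 2"
    unfolding span
    by (simp_all add: affine_translation[symmetric] subspace_imp_affine aff_dim_translation_eq
        aff_dim_subspace)
  then show ?thesis
    unfolding curve using parabola_in_plane_orthogonal[OF orth a' indep(2), of p'] by blast
qed

lemma TH2_zeta1_neg:
  assumes "(x, y) \<in> TH2"
  shows "x$2 - x$3 < 0"
proof -
  have "(x$3)^2 > (x$2)^2" and "x$3 > 0"
    using assms by (auto simp: TH2_def V_def lorentz_def power2_eq_square)
      (smt (verit) zero_le_square)
  then show ?thesis
    by (smt (verit) power_mono)
qed

lemma vec_eq_3: "(u::'a^3) = v \<longleftrightarrow> u$1 = v$1 \<and> u$2 = v$2 \<and> u$3 = v$3"
  by (simp add: vec_eq_iff forall_3)

text \<open>The entries of the matrices are quadratic polynomials in \<open>s\<close>.  The linear and quadratic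
  coefficients of the orbit are independent because \<open>x\<^sub>2 \<noteq> x\<^sub>3\<close> on \<open>T\<H>\<^sup>2\<close>: the first coordinate of
  the linear one is \<open>x\<^sub>3 - x\<^sub>2\<close>, that of the quadratic one is zero.\<close>

lemma orbit_is_parabola:
  assumes z: "z \<in> TH2"
  shows "\<exists>P. affine P \<and> aff_dim P = 2 \<and> parabola_in_plane P (orbit parabolic_rotations z)"
proof -
  obtain x y where z_eq: "z = (x, y)" by (metis surj_pair)
  define N :: "real^3 \<Rightarrow> real^3" where "N v = vector [v$3 - v$2, v$1, v$1]" for v
  define M :: "real^3 \<Rightarrow> real^3" where "M v = vector [0, (v$3 - v$2) / 2, (v$3 - v$2) / 2]" for v
  have rot: "parabolic_rotation s *v v = v + s *\<^sub>R N v + s^2 *\<^sub>R M v" for s v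
    by (simp add: vec_eq_3 parabolic_rotation_def matrix_vector_mult_def sum_3 N_def M_def
        field_simps)
  have orbit: "orbit parabolic_rotations z = {(x, y) + s *\<^sub>R (N x, N y) + s^2 *\<^sub>R (M x, M y) | s. True}"
    unfolding orbit_def parabolic_rotations_def z_eq by (auto simp flip: rot)
  have "x$3 - x$2 > 0"
    using TH2_zeta1_neg z by (simp add: z_eq)
  then have indep: "(N x, N y) \<noteq> 0" "(M x, M y) \<noteq> 0" "(N x, N y) \<noteq> r *\<^sub>R (M x, M y)" for r
    by (simp_all add: zero_prod_def vec_eq_3 N_def M_def)
  show ?thesis
    unfolding orbit by (rule parabola_in_plane_quadratic_curve) (rule indep)+
qed

section \<open>The image of the invariants\<close>

lemma vector_4 [simp]:
  "(vector [a, b, c, d] :: real^4) $ 1 = a" "(vector [a, b, c, d] :: real^4) $ 2 = b"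
  "(vector [a, b, c, d] :: real^4) $ 3 = c" "(vector [a, b, c, d] :: real^4) $ 4 = d"
  unfolding vector_def by simp_all

lemma vec_eq_4: "(u::'a^4) = v \<longleftrightarrow> u$1 = v$1 \<and> u$2 = v$2 \<and> u$3 = v$3 \<and> u$4 = v$4"
  by (simp add: vec_eq_iff forall_4)

lemma Gam_nth [simp]:
  "Gam z $ 1 = zeta1 z" "Gam z $ 2 = zeta2 z" "Gam z $ 3 = zeta3 z" "Gam z $ 4 = zeta6 z"
  by (simp_all add: Gam_def)

text \<open>Let \<open>n = (0, 1, 1)\<close>, the isotropic vector fixed by the group.  Then \<open>w\<^sub>1 = \<langle>x, n\<rangle>\<^sub>L\<close>,
  \<open>w\<^sub>2 = \<langle>y, n\<rangle>\<^sub>L\<close>, \<open>w\<^sub>3 = \<langle>y, y\<rangle>\<^sub>L\<close> and \<open>w\<^sub>4 = det (x, y, n)\<close>, and the relation says that the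
  square of this determinant is minus the Lorentzian Gram determinant of \<open>x, y, n\<close>.\<close>

lemma Gam_V_subset_Y: "Gam ` V \<subseteq> Y"
proof (clarsimp simp: Y_def)
  fix x y :: "real^3" assume "(x, y) \<in> V"
  then have "x$1 * x$1 + x$2 * x$2 - x$3 * x$3 + 1 = 0" "x$1 * y$1 + x$2 * y$2 - x$3 * y$3 = 0"
    by (auto simp: V_def lorentz_def)
  then show "(zeta6 (x, y))\<^sup>2 = (zeta1 (x, y))\<^sup>2 * zeta3 (x, y) - (zeta2 (x, y))\<^sup>2"
    unfolding zeta1_def zeta2_def zeta3_def zeta6_def prod.case by algebra
qed

text \<open>The preimage is the point with \<open>x\<^sub>1 = 0\<close>; then \<open>x\<^sub>2 + x\<^sub>3\<close> and \<open>y\<^sub>2 + y\<^sub>3\<close> are determined by the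
  two equations of \<open>V\<close>, and \<open>y\<^sub>1\<close> by \<open>w\<^sub>4\<close>.\<close>

lemma Gam_surj:
  assumes w: "w \<in> Y" and neg: "w$1 < 0"
  shows "w \<in> Gam ` TH2"
proof -
  define x :: "real^3" where "x = vector [0, (w$1 - 1 / w$1) / 2, (- w$1 - 1 / w$1) / 2]"
  define y :: "real^3" where
    "y = vector [- w$4 / w$1, (w$2 + w$2 / (w$1)^2) / 2, (w$2 / (w$1)^2 - w$2) / 2]"
  have w1: "w$1 \<noteq> 0" using neg by simp
  have Y: "(w$4)^2 = (w$1)^2 * w$3 - (w$2)^2" using w by (simp add: Y_def)
  have "(x, y) \<in> V"
    using w1 by (simp add: V_def lorentz_def x_def y_def field_simps power2_eq_square)
  moreover have "x$3 > 0"
    using neg by (simp add: x_def) (smt (verit) divide_pos_neg)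
  moreover have "Gam (x, y) = w"
  proof -
    have "zeta3 (x, y) = (w$4)^2 / (w$1)^2 + (w$2)^2 / (w$1)^2"
      using w1 by (simp add: zeta3_def x_def y_def field_simps power2_eq_square)
    also have "\<dots> = w$3" using w1 by (simp add: Y add_divide_distrib[symmetric])
    finally show ?thesis
      using w1 by (simp add: vec_eq_4 zeta1_def zeta2_def zeta6_def x_def y_def field_simps)
  qed
  ultimately show ?thesis by (force simp: TH2_def)
qed

lemma Gam_TH2: "Gam ` TH2 = {w \<in> Y. w$1 < 0}"
proof
  show "Gam ` TH2 \<subseteq> {w \<in> Y. w$1 < 0}"
    using Gam_V_subset_Y TH2_zeta1_neg by (auto simp: TH2_def zeta1_def)
  show "{w \<in> Y. w$1 < 0} \<subseteq> Gam ` TH2" using Gam_surj by blast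
qed

lemma real_polynomial_function_nth: "real_polynomial_function (\<lambda>w::real^'n. w$i)"
  by (intro real_polynomial_function_linear bounded_linear_vec_nth)

lemma real_polynomial_function_infinite_zeros:
  fixes q :: "real \<Rightarrow> real"
  assumes "real_polynomial_function q" and "infinite {t. q t = 0}"
  shows "q t = 0"
proof -
  obtain a n where q: "q = (\<lambda>x. \<Sum>i\<le>n. a i * x^i)"
    using real_polynomial_function_imp_sum[OF assms(1)] by blast
  then show ?thesis
    using assms(2) polyfun_finite_roots[of a n] by auto
qed

lemma real_polynomial_function_line:
  fixes p :: "'a::euclidean_space \<Rightarrow> real"
  assumes "real_polynomial_function p"
  shows "real_polynomial_function (\<lambda>t::real. p (u + t *\<^sub>R v))"
proof -
  have "polynomial_function (\<lambda>t::real. u + t *\<^sub>R v)"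
    by (intro polynomial_function_add polynomial_function_const
        polynomial_function_bounded_linear bounded_linear_scaleR_left)
  from real_polynomial_function_compose[OF this assms] show ?thesis by (simp add: o_def)
qed

text \<open>All points of \<open>Y\<close> with \<open>w\<^sub>1 \<noteq> 0\<close> are in the image of \<open>V\<close>, the positive ones by the symmetry
  \<open>z \<mapsto> - z\<close>.  The others form the line \<open>w\<^sub>1 = w\<^sub>2 = w\<^sub>4 = 0\<close>.  A point of it with
  \<open>w\<^sub>3 = t \<ge> 0\<close> lies on the line \<open>s \<mapsto> (s, 0, t, s \<surd>t)\<close> in \<open>Y\<close>.  A point with \<open>w\<^sub>3 < 0\<close> is not even
  a limit of points with \<open>w\<^sub>1 \<noteq> 0\<close>, but a polynomial that vanishes on half of a line vanishes on the
  whole line.\<close>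

lemma zariski_closure_Gam_V: "zariski_closure (Gam ` V) = Y"
proof
  show "zariski_closure (Gam ` V) \<subseteq> Y"
  proof
    fix w assume w: "w \<in> zariski_closure (Gam ` V)"
    let ?p = "\<lambda>w::real^4. (w$4)^2 - (w$1)^2 * w$3 + (w$2)^2"
    have "real_polynomial_function ?p"
      by (intro polynomial_intros real_polynomial_function_nth)
    moreover have "\<forall>v\<in>Gam ` V. ?p v = 0"
      using Gam_V_subset_Y by (auto simp: Y_def)
    ultimately have "?p w = 0" using w unfolding zariski_closure_def by fast
    then show "w \<in> Y" by (simp add: Y_def)
  qed
  show "Y \<subseteq> zariski_closure (Gam ` V)"
    unfolding zariski_closure_def
  proof (intro subsetI CollectI allI impI)
    fix w p assume w: "w \<in> Y" and "real_polynomial_function p \<and> (\<forall>v\<in>Gam ` V. p v = 0)"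
    then have p: "real_polynomial_function p" and vanish: "\<And>v. v \<in> Gam ` V \<Longrightarrow> p v = 0"
      by auto
    have neg: "p w = 0" if "w \<in> Y" "w$1 < 0" for w
      using Gam_surj[OF that] by (intro vanish) (auto simp: TH2_def)
    have pos: "p w = 0" if "w \<in> Y" "w$1 > 0" for w
    proof -
      let ?w = "vector [- (w$1), - (w$2), w$3, w$4] :: real^4"
      have "?w \<in> Y" "?w $ 1 < 0" using that by (simp_all add: Y_def)
      from Gam_surj[OF this] obtain x y where xy: "(x, y) \<in> V" "?w = Gam (x, y)"
        by (auto simp: TH2_def)
      have "(- x, - y) \<in> V" using xy(1) by (auto simp: V_def lorentz_def)
      moreover have "Gam (- x, - y) = vector [- (?w$1), - (?w$2), ?w$3, ?w$4]"
        unfolding xy(2)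
        by (simp add: vec_eq_4 zeta1_def zeta2_def zeta3_def zeta6_def algebra_simps)
      then have "w = Gam (- x, - y)" by (simp add: vec_eq_4)
      ultimately show ?thesis by (intro vanish) blast
    qed
    show "p w = 0"
    proof (cases "w$1 = 0")
      case False
      then show ?thesis using neg pos w by (metis linorder_neqE_linordered_idom)
    next
      case True
      then have "(w$4)^2 + (w$2)^2 = 0" using w by (simp add: Y_def)
      then have w_eq: "w = 0 + w$3 *\<^sub>R axis 3 1"
        using True by (simp add: vec_eq_4 axis_def)
      \<comment> \<open>The half-line of points with \<open>s < 0\<close> suffices to conclude at \<open>s = 0\<close>.\<close>
      have half: "p (0 + t *\<^sub>R axis 3 1) = 0" if t: "t \<ge> 0" for t
      proof -
        let ?q = "\<lambda>s. p (t *\<^sub>R axis 3 1 + s *\<^sub>R vector [1, 0, 0, sqrt t])"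
        have "?q s = 0" if "s < 0" for s
          by (rule neg) (use that t in \<open>simp_all add: Y_def axis_def power_mult_distrib\<close>)
        then have "{..<0} \<subseteq> {s. ?q s = 0}" by auto
        then have "infinite {s. ?q s = 0}"
          using infinite_Iio infinite_super by blast
        from real_polynomial_function_infinite_zeros[OF real_polynomial_function_line[OF p] this, of 0]
        show ?thesis by simp
      qed
      then have "{0..} \<subseteq> {t. p (0 + t *\<^sub>R axis 3 1) = 0}" by auto
      then have "infinite {t. p (0 + t *\<^sub>R axis 3 1) = 0}"
        using infinite_Ici infinite_super by blast
      from real_polynomial_function_infinite_zeros[OF real_polynomial_function_line[OF p] this]
      show ?thesis by (subst w_eq)
    qed
  qed
qed

section \<open>Brackets of the invariants\<close>

text \<open>The Euclidean gradient at \<open>z\<close> of the \<open>i\<close>-th component of \<open>Gam\<close>.\<close>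

definition Gam_grad :: "4 \<Rightarrow> phase \<Rightarrow> phase" where
  "Gam_grad i z =
     (if i = 1 then (vector [0, 1, -1], 0)
      else if i = 2 then (0, vector [0, 1, -1])
      else if i = 3 then (0, 2 *\<^sub>R lorentz_dual (snd z))
      else (vector [snd z $ 2 - snd z $ 3, - (snd z $ 1), snd z $ 1],
            vector [fst z $ 3 - fst z $ 2, fst z $ 1, - (fst z $ 1)]))"

lemma zeta_eqs:
  "zeta1 z = fst z $ 2 - fst z $ 3" "zeta2 z = snd z $ 2 - snd z $ 3"
  "zeta3 z = (snd z $ 1)^2 + (snd z $ 2)^2 - (snd z $ 3)^2"
  "zeta6 z = fst z $ 1 * (snd z $ 2 - snd z $ 3) + snd z $ 1 * (fst z $ 3 - fst z $ 2)"
  by (simp_all add: zeta1_def zeta2_def zeta3_def zeta6_def case_prod_beta)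

lemma Gam_component_has_derivative:
  "((\<lambda>z. Gam z $ i) has_derivative (\<lambda>v. Gam_grad i z \<bullet> v)) (at z)"
proof -
  note [derivative_intros] = bounded_linear.has_derivative[OF bounded_linear_vec_nth]
  show ?thesis
    using exhaust_4[of i]
    by (elim disjE; simp add: Gam_grad_def zeta_eqs)
      (auto intro!: derivative_eq_intros ext simp: inner_prod_def inner_real3 algebra_simps)
qed

lemma Gam_component_polynomial: "real_polynomial_function (\<lambda>z. Gam z $ i)"
proof -
  have "real_polynomial_function (\<lambda>z::phase. fst z $ j)" "real_polynomial_function (\<lambda>z::phase. snd z $ j)"
    for j
    by (intro real_polynomial_function_linear bounded_linear_compose[OF bounded_linear_vec_nth]
        bounded_linear_fst bounded_linear_snd)+
  note poly = this polynomial_intros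
  show ?thesis
    using exhaust_4[of i] by (elim disjE; simp add: zeta_eqs) (intro poly)+
qed

lemma Gam_polynomial: "polynomial_function Gam"
  unfolding polynomial_function_iff_Basis_inner
  by (auto simp: Basis_vec_def inner_axis Gam_component_polynomial)

definition reduced_bivector :: "4 \<Rightarrow> 4 \<Rightarrow> real^4 \<Rightarrow> real" where
  "reduced_bivector i j w =
     (if (i, j) = (1, 2) then (w$1)^2 else if (i, j) = (2, 1) then - ((w$1)^2)
      else if (i, j) = (2, 3) then 2 * w$1 * w$3 else if (i, j) = (3, 2) then - (2 * w$1 * w$3)
      else if (i, j) = (3, 1) then - 2 * w$2 else if (i, j) = (1, 3) then 2 * w$2
      else 0)"

lemma reduced_bivector_skew: "reduced_bivector i j w = - reduced_bivector j i w"
  using exhaust_4[of i] exhaust_4[of j]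
  by (elim disjE) (simp_all add: reduced_bivector_def)

text \<open>The brackets of the invariants are polynomials in the invariants, so the invariants generate a
  Poisson subalgebra; \<open>\<zeta>\<^sub>6\<close> commutes with all of them.\<close>

lemma dirac_field_Gam_grad:
  assumes "z \<in> V"
  shows "dirac_field (Gam_grad i z) z \<bullet> Gam_grad j z = reduced_bivector i j (Gam z)"
proof -
  obtain x y where z: "z = (x, y)" by (metis surj_pair)
  have V: "x$1 * x$1 + x$2 * x$2 - x$3 * x$3 + 1 = 0" "x$1 * y$1 + x$2 * y$2 - x$3 * y$3 = 0"
    using assms by (auto simp: V_def lorentz_def z)
  note eqs = z Gam_grad_def dirac_field_inner lorentz_def inner_real3 reduced_bivector_def zeta_eqs
  have 12: "dirac_field (Gam_grad 1 z) z \<bullet> Gam_grad 2 z = reduced_bivector 1 2 (Gam z)"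
    by (simp add: eqs power2_eq_square)
  have 23: "dirac_field (Gam_grad 2 z) z \<bullet> Gam_grad 3 z = reduced_bivector 2 3 (Gam z)"
    using V by (simp add: eqs) algebra
  have 31: "dirac_field (Gam_grad 3 z) z \<bullet> Gam_grad 1 z = reduced_bivector 3 1 (Gam z)"
    using V by (simp add: eqs)
  have 14: "dirac_field (Gam_grad 1 z) z \<bullet> Gam_grad 4 z = reduced_bivector 1 4 (Gam z)"
    by (simp add: eqs algebra_simps)
  have 24: "dirac_field (Gam_grad 2 z) z \<bullet> Gam_grad 4 z = reduced_bivector 2 4 (Gam z)"
    by (simp add: eqs algebra_simps)
  have 34: "dirac_field (Gam_grad 3 z) z \<bullet> Gam_grad 4 z = reduced_bivector 3 4 (Gam z)"
    by (simp add: eqs algebra_simps)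
  have diag: "dirac_field (Gam_grad k z) z \<bullet> Gam_grad k z = reduced_bivector k k (Gam z)" for k
    using dirac_field_skew[of "Gam_grad k z" z "Gam_grad k z"] reduced_bivector_skew[of k k "Gam z"]
    by linarith
  have swap: "dirac_field (Gam_grad k z) z \<bullet> Gam_grad l z = reduced_bivector k l (Gam z)"
    if "dirac_field (Gam_grad l z) z \<bullet> Gam_grad k z = reduced_bivector l k (Gam z)" for k l
    using that dirac_field_skew[of "Gam_grad k z" z "Gam_grad l z"] reduced_bivector_skew[of k l "Gam z"]
    by linarith
  note brackets = diag 12 23 31 14 24 34
  show ?thesis
    using exhaust_4[of i] exhaust_4[of j]
    by (elim disjE; simp only: brackets brackets[THEN swap])
qed

lemma dirac_bracket_Gam:
  assumes "dirac_poisson_bracket B" "z \<in> V"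
  shows "B (\<lambda>u\<in>V. Gam u $ i) (\<lambda>u\<in>V. Gam u $ j) z = reduced_bivector i j (Gam z)"
  using dirac_bracket_gradients[OF assms Gam_component_polynomial Gam_component_has_derivative
      Gam_component_polynomial Gam_component_has_derivative, of i j]
  by (simp only: dirac_field_Gam_grad[OF assms(2)])

lemma reduced_bivector_polynomial: "real_polynomial_function (reduced_bivector i j)"
proof -
  have "real_polynomial_function (\<lambda>w. if c then f w else g w)"
    if "real_polynomial_function f" "real_polynomial_function g" for c and f g :: "real^4 \<Rightarrow> real"
    using that by (cases c) simp_all
  note if_poly = this
  show ?thesis
    unfolding reduced_bivector_def[abs_def]
    by (intro if_poly polynomial_intros real_polynomial_function_nth)
qed

lemma wcoord_eq: "wcoord i = (\<lambda>w\<in>Y. w \<bullet> axis i 1)"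
  by (simp add: wcoord_def inner_axis)

lemma wcoord_coord_ring: "wcoord i \<in> coord_ring Y"
  unfolding wcoord_eq by (rule coord_ring_coord)

lemma Basis_real4: "b \<in> (Basis :: (real^4) set) \<longleftrightarrow> (\<exists>i. b = axis i 1)"
  by (auto simp: Basis_vec_def)

lemma induced_bracket_on_Y_exists:
  assumes B: "dirac_poisson_bracket B"
  shows "\<exists>B'. induces_bracket Gam V B Y B'"
proof (rule induced_bracket_exists)
  show "poisson_bracket V B" using B unfolding dirac_poisson_bracket_def by blast
  show "polynomial_function Gam" by (rule Gam_polynomial)
  show "Gam ` V \<subseteq> Y" by (rule Gam_V_subset_Y)
  show "Y \<subseteq> zariski_closure (Gam ` V)" by (simp only: zariski_closure_Gam_V)
  fix b c :: "real^4" assume "b \<in> Basis" "c \<in> Basis"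
  then obtain i j where [simp]: "b = axis i 1" "c = axis j 1" by (auto simp: Basis_real4)
  have "B (\<lambda>u\<in>V. Gam u \<bullet> b) (\<lambda>u\<in>V. Gam u \<bullet> c) u = (\<lambda>w\<in>Y. reduced_bivector i j w) (Gam u)"
    if "u \<in> V" for u
  proof -
    have "Gam u \<in> Y" using that Gam_V_subset_Y by blast
    then show ?thesis using dirac_bracket_Gam[OF B that, of i j] by (simp add: inner_axis)
  qed
  then show "\<exists>r\<in>coord_ring Y. \<forall>u\<in>V. B (\<lambda>u\<in>V. Gam u \<bullet> b) (\<lambda>u\<in>V. Gam u \<bullet> c) u = r (Gam u)"
    by (intro bexI[of _ "\<lambda>w\<in>Y. reduced_bivector i j w"] ballI coord_ringI
        reduced_bivector_polynomial)
qed

text \<open>On the image of \<open>V\<close> the values are forced by the bracket of \<open>V\<close>.  On the rest of \<open>Y\<close>, the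
  points with \<open>w\<^sub>1 = 0\<close>, they follow because the difference of both sides is a polynomial
  and the image is Zariski dense.\<close>

lemma induced_bracket_on_Y_values:
  assumes B: "dirac_poisson_bracket B" and B': "induces_bracket Gam V B Y B'" and w: "w \<in> Y"
  shows "B' (wcoord i) (wcoord j) w = reduced_bivector i j w"
proof -
  have "poisson_bracket Y B'"
    using B' unfolding induces_bracket_def by blast
  then have "B' (wcoord i) (wcoord j) \<in> coord_ring Y"
    using wcoord_coord_ring unfolding poisson_bracket_def by blast
  then obtain p where p: "real_polynomial_function p" and p_eq: "B' (wcoord i) (wcoord j) = (\<lambda>w\<in>Y. p w)"
    by (rule coord_ringE)
  have pull: "(\<lambda>u\<in>V. wcoord i (Gam u)) = (\<lambda>u\<in>V. Gam u $ i)" for i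
    by (rule restrict_ext) (use Gam_V_subset_Y in \<open>auto simp: wcoord_def\<close>)
  have "p (Gam z) - reduced_bivector i j (Gam z) = 0" if z: "z \<in> V" for z
  proof -
    have "Gam z \<in> Y" using z Gam_V_subset_Y by blast
    moreover have "B (\<lambda>u\<in>V. Gam u $ i) (\<lambda>u\<in>V. Gam u $ j) z = B' (wcoord i) (wcoord j) (Gam z)"
      unfolding pull[symmetric]
      using B' wcoord_coord_ring z unfolding induces_bracket_def by blast
    ultimately show ?thesis
      using dirac_bracket_Gam[OF B z, of i j] by (simp add: p_eq)
  qed
  moreover have "real_polynomial_function (\<lambda>w. p w - reduced_bivector i j w)"
    by (intro real_polynomial_function_diff p reduced_bivector_polynomial)
  ultimately have "p w - reduced_bivector i j w = 0"
    using w unfolding zariski_closure_Gam_V[symmetric] zariski_closure_def by fast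
  then show ?thesis using w by (simp add: p_eq)
qed

lemma reduced_relations_values:
  assumes P: "poisson_bracket Y B" and R: "reduced_relations B" and w: "w \<in> Y"
  shows "B (wcoord i) (wcoord j) w = reduced_bivector i j w"
proof -
  have D: "skew_biderivation Y B" using P unfolding poisson_bracket_iff by (rule conjunct1)
  note skew = biderivation_skew[OF D wcoord_coord_ring wcoord_coord_ring w]
  have val: "B (wcoord 1) (wcoord 2) w = (w$1)^2" "B (wcoord 2) (wcoord 3) w = 2 * w$1 * w$3"
    "B (wcoord 3) (wcoord 1) w = - 2 * w$2" "B (wcoord 1) (wcoord 4) w = 0"
    "B (wcoord 2) (wcoord 4) w = 0" "B (wcoord 3) (wcoord 4) w = 0"
    using R w unfolding reduced_relations_def by blast+
  have diag: "B (wcoord k) (wcoord k) w = 0" for k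
    by (rule biderivation_self[OF D wcoord_coord_ring w])
  show ?thesis
    using exhaust_4[of i] exhaust_4[of j] val diag[of i]
      skew[of 2 1] skew[of 3 2] skew[of 1 3] skew[of 4 1] skew[of 4 2] skew[of 4 3]
    by (elim disjE) (simp_all add: reduced_bivector_def)
qed

lemma induced_bracket_reduced_relations:
  assumes "dirac_poisson_bracket B" "induces_bracket Gam V B Y B'"
  shows "reduced_relations B'"
  unfolding reduced_relations_def
  using induced_bracket_on_Y_values[OF assms] by (auto simp: reduced_bivector_def)

lemma reduced_bracket_unique:
  assumes B: "poisson_bracket Y B" "reduced_relations B"
    and B': "poisson_bracket Y B'" "reduced_relations B'"
    and "f \<in> coord_ring Y" "g \<in> coord_ring Y"
  shows "B f g = B' f g"
proof (rule biderivation_eqI[of Y B B'])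
  show "skew_biderivation Y B" using B(1) unfolding poisson_bracket_iff by (rule conjunct1)
  show "skew_biderivation Y B'" using B'(1) unfolding poisson_bracket_iff by (rule conjunct1)
  show "B (\<lambda>u\<in>Y. u \<bullet> b) (\<lambda>u\<in>Y. u \<bullet> c) z = B' (\<lambda>u\<in>Y. u \<bullet> b) (\<lambda>u\<in>Y. u \<bullet> c) z"
    if "b \<in> Basis" "c \<in> Basis" "z \<in> Y" for b c z
    using that reduced_relations_values[OF B] reduced_relations_values[OF B']
    by (auto simp: Basis_real4 wcoord_eq[symmetric] simp del: restrict_apply)
qed fact+

section \<open>Reduction of the equations of motion\<close>

lemma lorentz_grad_axisymmetric:
  assumes "(U has_real_derivative D) (at (x$2 - x$3))"
  shows "lorentz_grad (\<lambda>x. U (x$2 - x$3)) x = D *\<^sub>R vector [0, 1, 1]"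
proof -
  note [derivative_intros] = bounded_linear.has_derivative[OF bounded_linear_vec_nth]
  have "((\<lambda>x. U (x$2 - x$3)) has_derivative (\<lambda>v. (v$2 - v$3) * D)) (at x)"
    by (intro DERIV_compose_FDERIV[where f = U and g = "\<lambda>x. x$2 - x$3"] assms) (auto intro!: derivative_eq_intros)
  then have "partial_deriv (\<lambda>x. U (x$2 - x$3)) v x = (v$2 - v$3) * D" for v
    by (rule partial_deriv_eq_frechet)
  then show ?thesis
    by (simp add: lorentz_grad_def vec_eq_3 axis_def)
qed

lemma hamiltonian_has_derivative:
  assumes "(U has_real_derivative D) (at (zeta1 z))"
  shows "(hamiltonian U has_derivative (\<lambda>v. ((1/2) *\<^sub>R Gam_grad 3 z + D *\<^sub>R Gam_grad 1 z) \<bullet> v)) (at z)"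
proof -
  have 1: "(zeta1 has_derivative (\<lambda>v. Gam_grad 1 z \<bullet> v)) (at z)"
    and 3: "(zeta3 has_derivative (\<lambda>v. Gam_grad 3 z \<bullet> v)) (at z)"
    using Gam_component_has_derivative[of 1 z] Gam_component_has_derivative[of 3 z] by simp_all
  have "((\<lambda>z. U (zeta1 z)) has_derivative (\<lambda>v. D * (Gam_grad 1 z \<bullet> v))) (at z)"
    using DERIV_compose_FDERIV[OF assms 1] by (simp add: mult.commute)
  from has_derivative_add[OF has_derivative_mult_right[OF 3, of "1/2"] this]
  show ?thesis
    by (simp add: hamiltonian_def[abs_def] inner_add_left)
qed

text \<open>The equations of motion are Hamilton's equations for the Dirac-Poisson bracket.  The sign
  arises since the field of \<open>H\<close> in the sense of \<open>dirac_field\<close> has the components \<open>{H, z\<^sub>b}\<close>,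
  while the motion is \<open>{z\<^sub>b, H}\<close>.\<close>

lemma motion_field_eq_dirac_field:
  assumes z: "z \<in> V" and U: "(U has_real_derivative D) (at (zeta1 z))"
  shows "motion_field U z = - dirac_field ((1/2) *\<^sub>R Gam_grad 3 z + D *\<^sub>R Gam_grad 1 z) z"
proof -
  obtain x y where z_eq: "z = (x, y)" by (metis surj_pair)
  have xy: "x \<bullet> lorentz_dual y = 0"
    using z lorentz_dual_inner[of y x] by (simp add: z_eq V_def inner_commute lorentz_commute)
  have grad: "lorentz_grad (\<lambda>x. U (x$2 - x$3)) x = D *\<^sub>R vector [0, 1, 1]"
    using U by (intro lorentz_grad_axisymmetric) (simp add: z_eq zeta_eqs)
  have field: "(1/2) *\<^sub>R Gam_grad 3 z + D *\<^sub>R Gam_grad 1 z = (D *\<^sub>R vector [0, 1, -1], lorentz_dual y)"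
    by (simp add: Gam_grad_def z_eq)
  show ?thesis
    unfolding field
    by (simp add: motion_field_def z_eq grad dirac_field_def xy Let_def)
      (simp add: vec_eq_3 inner_real3 lorentz_def algebra_simps)
qed

lemma dirac_hamilton_equations:
  assumes B: "dirac_poisson_bracket B" and z: "z \<in> V"
    and U: "(U has_real_derivative D) (at (zeta1 z))" and b: "b \<in> Basis"
  shows "bracket_ext V B (\<lambda>u\<in>V. u \<bullet> b) (hamiltonian U) z = motion_field U z \<bullet> b"
proof -
  let ?K = "(1/2) *\<^sub>R Gam_grad 3 z + D *\<^sub>R Gam_grad 1 z"
  note H = hamiltonian_has_derivative[OF U]
  have "bracket_ext V B (\<lambda>u\<in>V. u \<bullet> b) (hamiltonian U) z = dirac_field b z \<bullet> ?K"
    by (simp only: dirac_bracket_ext[OF B z b differentiableI[OF H]] partial_deriv_eq_frechet[OF H]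
        inner_commute)
  also have "\<dots> = motion_field U z \<bullet> b"
    unfolding motion_field_eq_dirac_field[OF z U] by (subst dirac_field_skew) simp
  finally show ?thesis .
qed

lemma reduced_field_eq_bivector:
  assumes "deriv U (w$1) = D"
  shows "reduced_field U w $ i = reduced_bivector i 3 w / 2 + D * reduced_bivector i 1 w"
  using exhaust_4[of i] assms
  by (elim disjE) (simp_all add: reduced_field_def reduced_bivector_def)

text \<open>Differentiating an invariant along the motion is bracketing it with \<open>H\<close>, a function of the
  invariants; so the bivector of the invariants determines the result.\<close>

lemma Gam_derivative_along_motion:
  assumes z: "z \<in> V" and U: "(U has_real_derivative D) (at (zeta1 z))"
  shows "Gam_grad i z \<bullet> motion_field U z = reduced_field U (Gam z) $ i"
proof -
  have "Gam_grad i z \<bullet> motion_field U z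
      = dirac_field (Gam_grad i z) z \<bullet> ((1/2) *\<^sub>R Gam_grad 3 z + D *\<^sub>R Gam_grad 1 z)"
    unfolding motion_field_eq_dirac_field[OF assms] by (subst dirac_field_skew) (simp add: inner_commute)
  also have "\<dots> = reduced_bivector i 3 (Gam z) / 2 + D * reduced_bivector i 1 (Gam z)"
    by (simp add: inner_add_right dirac_field_Gam_grad[OF z])
  also have "\<dots> = reduced_field U (Gam z) $ i"
    by (rule reduced_field_eq_bivector[symmetric]) (simp add: DERIV_imp_deriv[OF U])
  finally show ?thesis .
qed

lemma Gam_maps_solutions:
  assumes c: "solution_on (motion_field U) D I c" and "D \<subseteq> V"
    and U: "\<And>z. z \<in> D \<Longrightarrow> (U has_real_derivative deriv U (zeta1 z)) (at (zeta1 z))"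
    and E: "Gam ` D \<subseteq> E"
  shows "solution_on (reduced_field U) E I (\<lambda>t. Gam (c t))"
  unfolding solution_on_def
proof (intro conjI ballI)
  show "is_interval I" using c by (simp add: solution_on_def)
  fix t assume t: "t \<in> I"
  then have ct: "c t \<in> D" and dc: "(c has_vector_derivative motion_field U (c t)) (at t within I)"
    using c by (auto simp: solution_on_def)
  show "Gam (c t) \<in> E" using E ct by blast
  have "(Gam has_derivative (\<lambda>v. \<chi> i. Gam_grad i (c t) \<bullet> v)) (at (c t))"
    unfolding has_derivative_componentwise_within[of Gam]
    by (auto simp: Basis_real4 inner_axis Gam_component_has_derivative)
  then have "(Gam has_derivative (\<lambda>v. \<chi> i. Gam_grad i (c t) \<bullet> v)) (at (c t) within c ` I)"
    by (rule has_derivative_at_withinI)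
  from vector_derivative_diff_chain_within[OF dc this]
  have "((\<lambda>t. Gam (c t)) has_vector_derivative (\<chi> i. Gam_grad i (c t) \<bullet> motion_field U (c t)))
      (at t within I)"
    by (simp add: o_def)
  also have "(\<chi> i. Gam_grad i (c t) \<bullet> motion_field U (c t)) = reduced_field U (Gam (c t))"
    using Gam_derivative_along_motion[OF _ U[OF ct]] ct \<open>D \<subseteq> V\<close> by (auto simp: vec_eq_iff)
  finally show "((\<lambda>t. Gam (c t)) has_vector_derivative reduced_field U (Gam (c t))) (at t within I)" .
qed

lemma reduced_hamiltonian_has_derivative:
  assumes "(U has_real_derivative D) (at (w$1))"
  shows "(reduced_hamiltonian U has_derivative (\<lambda>v. v$3 / 2 + D * v$1)) (at w)"
proof -
  have nth: "((\<lambda>w::real^4. w$i) has_derivative (\<lambda>v. v$i)) (at w)" for i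
    by (rule bounded_linear_imp_has_derivative) (rule bounded_linear_vec_nth)
  have "((\<lambda>w. U (w$1)) has_derivative (\<lambda>v. D * v$1)) (at w)"
    using DERIV_compose_FDERIV[where f = U and g = "\<lambda>w. w$1", OF assms nth] by (simp add: mult.commute)
  from has_derivative_add[OF has_derivative_mult_right[OF nth[of 3], of "1/2"] this]
  show ?thesis by (simp add: reduced_hamiltonian_def[abs_def])
qed

lemma reduced_hamilton_equations:
  assumes B: "dirac_poisson_bracket B" "induces_bracket Gam V B Y B'" and w: "w \<in> Y"
    and U: "(U has_real_derivative D) (at (w$1))"
  shows "bracket_ext Y B' (wcoord i) (reduced_hamiltonian U) w = reduced_field U w $ i"
proof -
  have inj: "inj (\<lambda>j::4. axis j (1::real))" by (auto simp: inj_on_def axis_eq_axis)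
  have Basis: "Basis = range (\<lambda>j::4. axis j (1::real))" by (auto simp: Basis_real4)
  have "bracket_ext Y B' (wcoord i) (reduced_hamiltonian U) w
      = (\<Sum>j\<in>UNIV. B' (wcoord i) (wcoord j) w * partial_deriv (reduced_hamiltonian U) (axis j 1) w)"
    unfolding bracket_ext_def Basis sum.reindex[OF inj] o_def wcoord_eq ..
  also have "\<dots> = (\<Sum>j\<in>UNIV. reduced_bivector i j w * ((axis j 1 :: real^4)$3 / 2 + D * (axis j 1 :: real^4)$1))"
    by (simp only: induced_bracket_on_Y_values[OF B w]
        partial_deriv_eq_frechet[OF reduced_hamiltonian_has_derivative[OF U]])
  also have "\<dots> = reduced_bivector i 3 w / 2 + D * reduced_bivector i 1 w"
    by (simp add: sum_4 axis_def)
  also have "\<dots> = reduced_field U w $ i"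
    by (rule reduced_field_eq_bivector[symmetric]) (rule DERIV_imp_deriv[OF U])
  finally show ?thesis .
qed

lemma first_integralI:
  assumes "\<And>w. w \<in> D \<Longrightarrow> \<exists>f'. (f has_derivative f') (at w) \<and> f' (F w) = 0"
  shows "first_integral F D f"
  unfolding first_integral_def
proof (intro allI impI)
  fix I c assume c: "solution_on F D I c"
  have "((\<lambda>t. f (c t)) has_derivative (\<lambda>h. 0)) (at t within I)" if t: "t \<in> I" for t
  proof -
    have "c t \<in> D" and dc: "(c has_vector_derivative F (c t)) (at t within I)"
      using c t by (auto simp: solution_on_def)
    then obtain f' where f': "(f has_derivative f') (at (c t))" "f' (F (c t)) = 0"
      using assms by blast
    have "((f \<circ> c) has_vector_derivative f' (F (c t))) (at t within I)"
      by (rule vector_derivative_diff_chain_within[OF dc has_derivative_at_withinI[OF f'(1)]])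
    then show ?thesis by (simp add: f'(2) has_vector_derivative_def o_def)
  qed
  moreover have "convex I" using c by (simp add: solution_on_def is_interval_convex)
  ultimately show "\<exists>k. \<forall>t\<in>I. f (c t) = k"
    by (metis has_derivative_zero_constant)
qed

lemma first_integral_reduced_hamiltonian:
  assumes "\<And>w. w \<in> E \<Longrightarrow> (U has_real_derivative deriv U (w$1)) (at (w$1))"
  shows "first_integral (reduced_field U) E (reduced_hamiltonian U)"
  by (rule first_integralI, rule exI, rule conjI,
      rule reduced_hamiltonian_has_derivative[OF assms]) (simp_all add: reduced_field_def)

lemma first_integral_w4: "first_integral (reduced_field U) E (\<lambda>w. w$4)"
  by (rule first_integralI, rule exI, rule conjI, rule bounded_linear_imp_has_derivative,
      rule bounded_linear_vec_nth) (simp add: reduced_field_def)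

lemma rational_function_has_derivative:
  fixes p q :: "real poly"
  assumes "U = (\<lambda>t. poly p t / poly q t)" "poly q s \<noteq> 0"
  shows "(U has_real_derivative deriv U s) (at s)"
proof -
  have "((\<lambda>t. poly p t / poly q t) has_real_derivative
      (poly (pderiv p) s * poly q s - poly p s * poly (pderiv q) s) / (poly q s * poly q s)) (at s)"
    by (rule DERIV_divide[OF poly_DERIV poly_DERIV assms(2)])
  then show ?thesis using DERIV_imp_deriv assms(1) by metis
qed

theorem proposition3p15:
  shows
    "(\<forall>z\<in>TH2. \<exists>P. affine P \<and> aff_dim P = 2 \<and>
        parabola_in_plane P (orbit parabolic_rotations z)) \<and>
     Gam ` V \<subseteq> Y \<and>
     Gam ` TH2 = {w \<in> Y. w$1 < 0} \<and> zariski_closure (Gam ` V) = Y \<and>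
     (\<exists>B. dirac_poisson_bracket B) \<and>
     (\<forall>B. dirac_poisson_bracket B \<longrightarrow>
        (\<exists>B'. induces_bracket Gam V B Y B') \<and>
        (\<forall>B'. induces_bracket Gam V B Y B' \<longrightarrow>
           reduced_relations B' \<and>
           (\<forall>B''. poisson_bracket Y B'' \<and> reduced_relations B'' \<longrightarrow>
              (\<forall>\<phi>\<in>coord_ring Y. \<forall>\<psi>\<in>coord_ring Y. B'' \<phi> \<psi> = B' \<phi> \<psi>)) \<and>
           (\<forall>(p::real poly) (q::real poly) U D E.
              q \<noteq> 0 \<and> U = (\<lambda>t. poly p t / poly q t) \<and>
              D = {z \<in> TH2. poly q (zeta1 z) \<noteq> 0} \<and>
              E = {w \<in> Y. poly q (w$1) \<noteq> 0} \<longrightarrow>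
                (\<forall>z\<in>D. \<forall>i.
                   bracket_ext V B (xcoord i) (hamiltonian U) z = fst (motion_field U z) $ i \<and>
                   bracket_ext V B (ycoord i) (hamiltonian U) z = snd (motion_field U z) $ i) \<and>
                (\<forall>w\<in>E. \<forall>i.
                   bracket_ext Y B' (wcoord i) (reduced_hamiltonian U) w = reduced_field U w $ i) \<and>
                (\<forall>I c. solution_on (motion_field U) D I c \<longrightarrow>
                       solution_on (reduced_field U) E I (\<lambda>t. Gam (c t))) \<and>
                first_integral (reduced_field U) E (reduced_hamiltonian U) \<and>
                first_integral (reduced_field U) E (\<lambda>w. w$4))))"
proof (intro conjI ballI allI impI)
  show "\<exists>P. affine P \<and> aff_dim P = 2 \<and> parabola_in_plane P (orbit parabolic_rotations z)"
    if "z \<in> TH2" for z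
    by (rule orbit_is_parabola[OF that])
  show "Gam ` V \<subseteq> Y" by (rule Gam_V_subset_Y)
  show "Gam ` TH2 = {w \<in> Y. w$1 < 0}" by (rule Gam_TH2)
  show "zariski_closure (Gam ` V) = Y" by (rule zariski_closure_Gam_V)
  show "\<exists>B. dirac_poisson_bracket B" by (rule dirac_poisson_bracket_exists)
next
  fix B assume B: "dirac_poisson_bracket B"
  show "\<exists>B'. induces_bracket Gam V B Y B'" by (rule induced_bracket_on_Y_exists[OF B])
  fix B' assume B': "induces_bracket Gam V B Y B'"
  show R: "reduced_relations B'" by (rule induced_bracket_reduced_relations[OF B B'])
  show "B'' \<phi> \<psi> = B' \<phi> \<psi>"
    if "poisson_bracket Y B'' \<and> reduced_relations B''" "\<phi> \<in> coord_ring Y" "\<psi> \<in> coord_ring Y"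
    for B'' \<phi> \<psi>
    using that B' R by (intro reduced_bracket_unique) (auto simp: induces_bracket_def)
  fix p q :: "real poly" and U D E
  assume "q \<noteq> 0 \<and> U = (\<lambda>t. poly p t / poly q t) \<and> D = {z \<in> TH2. poly q (zeta1 z) \<noteq> 0} \<and>
    E = {w \<in> Y. poly q (w$1) \<noteq> 0}"
  then have U: "U = (\<lambda>t. poly p t / poly q t)" and D: "D = {z \<in> TH2. poly q (zeta1 z) \<noteq> 0}"
    and E: "E = {w \<in> Y. poly q (w$1) \<noteq> 0}" by auto
  have UD: "(U has_real_derivative deriv U (zeta1 z)) (at (zeta1 z))" if "z \<in> D" for z
    using that D by (intro rational_function_has_derivative[OF U]) simp
  have UE: "(U has_real_derivative deriv U (w$1)) (at (w$1))" if "w \<in> E" for w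
    using that E by (intro rational_function_has_derivative[OF U]) simp
  have DV: "D \<subseteq> V" by (auto simp: D TH2_def)
  {
    fix z i assume z: "z \<in> D"
    note hamilton = dirac_hamilton_equations[OF B _ UD[OF z]]
    show "bracket_ext V B (xcoord i) (hamiltonian U) z = fst (motion_field U z) $ i"
      unfolding xcoord_eq
      by (subst hamilton) (use z DV in \<open>auto simp: inner_prod_def inner_axis\<close>)
    show "bracket_ext V B (ycoord i) (hamiltonian U) z = snd (motion_field U z) $ i"
      unfolding ycoord_eq
      by (subst hamilton) (use z DV in \<open>auto simp: inner_prod_def inner_axis\<close>)
  }
  show "bracket_ext Y B' (wcoord i) (reduced_hamiltonian U) w = reduced_field U w $ i"
    if "w \<in> E" for w i
    using that by (intro reduced_hamilton_equations[OF B B' _ UE]) (auto simp: E)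
  show "solution_on (reduced_field U) E I (\<lambda>t. Gam (c t))"
    if "solution_on (motion_field U) D I c" for I c
    by (rule Gam_maps_solutions[OF that DV UD])
      (use Gam_V_subset_Y DV in \<open>auto simp: D E\<close>)
  show "first_integral (reduced_field U) E (reduced_hamiltonian U)"
    by (rule first_integral_reduced_hamiltonian[OF UE])
  show "first_integral (reduced_field U) E (\<lambda>w. w$4)" by (rule first_integral_w4)
qed

end
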